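(* Let $c\in\mathbb{F}\setminus\{0\}$, let $j\in\mathbb{N}\setminus\{0\}$, let $d\in\mathbb{F}[\alpha_1,\ldots,\alpha_n]$ be an irreducible polynomial with $d\nsim_\sigma\alpha_n$, and let $a\in\mathbb{F}(\alpha_1,\ldots,\alpha_{n-1})[\alpha_n]$ with $\deg_{\alpha_n}(a)<\deg_{\alpha_n}(d)$. Put $f=\frac{a}{d^j}$. If $\mathrm{Spr}_\sigma(d,d)=\{0\}$, then $f$ is $c\sigma$-summable in $\mathbb{F}(\alpha_1,\ldots,\alpha_n)$ if and only if $a=0$.
   Context: $\mathbb{F}$ is a subfield of $\overline{\mathbb{Q}}$, $n\ge1$, $\lambda_1,\ldots,\lambda_n\in\mathbb{F}\setminus\{0\}$, and $\sigma$ is the field automorphism of the rational function field $\mathbb{F}(\alpha_1,\ldots,\alpha_n)$ with $\sigma|_{\mathbb{F}}=\mathrm{id}$ and $\sigma(\alpha_i)=\lambda_i\alpha_i$. For $n=1$, $\mathbb{F}(\alpha_1,\ldots,\alpha_{n-1})$ means $\mathbb{F}$. The degree of the zero polynomial is $-\infty$. For polynomials $p,q\in\mathbb{F}[\alpha_1,\ldots,\alpha_n]$, $\mathrm{Spr}_\sigma(p,q)=\{k\in\mathbb{Z}\mid\sigma^k(p)=c'q\text{ for some }c'\in\mathbb{F}\setminus\{0\}\}$; one writes $p\sim_\sigma q$ if $\mathrm{Spr}_\sigma(p,q)\ne\emptyset$ and $p\nsim_\sigma q$ otherwise. A rational function $f$ is $c\sigma$-summable in $\mathbb{F}(\alpha_1,\ldots,\alpha_n)$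 if $f=c\sigma(g)-g$ for some $g\in\mathbb{F}(\alpha_1,\ldots,\alpha_n)$. *)

theory Defs
  imports
    "HOL-Algebra.QuotRing"
    "HOL-Algebra.Ring_Divisibility"
    "HOL-Algebra.Algebraic_Closure_Type"
    "HOL-Computational_Algebra.Polynomial_Factorial"
    "HOL-Library.Poly_Mapping"
    "HOL-Library.Extended_Real"
begin

text \<open>
  All objects live in the single ambient type \<open>ratfun\<close>, the field of rational functions
  over the complex numbers in variables indexed by the natural numbers. For a subfield \<open>F\<close>
  of the complex numbers, \<open>F[\<alpha>\<^sub>1,\<dots>,\<alpha>\<^sub>n]\<close> and \<open>F(\<alpha>\<^sub>1,\<dots>,\<alpha>\<^sub>n)\<close> are subsets of it.
\<close>

type_synonym mpoly = "(nat \<Rightarrow>\<^sub>0 nat) \<Rightarrow>\<^sub>0 complex"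
type_synonym ratfun = "mpoly fract"

definition const :: "complex \<Rightarrow> ratfun" where
  "const c = to_fract (Poly_Mapping.single 0 c)"

definition alpha :: "nat \<Rightarrow> ratfun" where
  "alpha i = to_fract (Poly_Mapping.single (Poly_Mapping.single i 1) 1)"

text \<open>\<open>F[\<alpha>\<^sub>1,\<dots>,\<alpha>\<^sub>n]\<close> and \<open>F(\<alpha>\<^sub>1,\<dots>,\<alpha>\<^sub>n)\<close>; for \<open>n = 0\<close> both are the constants from \<open>F\<close>.\<close>

definition polys :: "complex set \<Rightarrow> nat \<Rightarrow> ratfun set" where
  "polys F n = to_fract ` {p. \<forall>m \<in> Poly_Mapping.keys p.
      Poly_Mapping.lookup p m \<in> F \<and> Poly_Mapping.keys m \<subseteq> {1..n}}"

definition ratfuns :: "complex set \<Rightarrow> nat \<Rightarrow> ratfun set" where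
  "ratfuns F n = {p / q | p q. p \<in> polys F n \<and> q \<in> polys F n \<and> q \<noteq> 0}"

definition polys_ring :: "complex set \<Rightarrow> nat \<Rightarrow> ratfun ring" where
  "polys_ring F n = ring_of_type_algebra\<lparr>carrier := polys F n\<rparr>"

definition ratfuns_ring :: "complex set \<Rightarrow> nat \<Rightarrow> ratfun ring" where
  "ratfuns_ring F n = ring_of_type_algebra\<lparr>carrier := ratfuns F n\<rparr>"

text \<open>
  \<open>F(\<alpha>\<^sub>1,\<dots>,\<alpha>\<^sub>n\<^sub>-\<^sub>1)[\<alpha>\<^sub>n]\<close> and the degree in \<open>\<alpha>\<^sub>n\<close> of its elements, for \<open>n \<ge> 1\<close>. The univariate
  polynomial \<open>A\<close> representing an element is unique because \<open>\<alpha>\<^sub>n\<close> is transcendental over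
  \<open>F(\<alpha>\<^sub>1,\<dots>,\<alpha>\<^sub>n\<^sub>-\<^sub>1)\<close>. The ring contains \<open>F[\<alpha>\<^sub>1,\<dots>,\<alpha>\<^sub>n]\<close>, and on that subring
  this is the usual degree in \<open>\<alpha>\<^sub>n\<close>.
\<close>

definition polys_last :: "complex set \<Rightarrow> nat \<Rightarrow> ratfun set" where
  "polys_last F n = {poly A (alpha n) | A. \<forall>i. Polynomial.coeff A i \<in> ratfuns F (n - 1)}"

definition deg_last :: "complex set \<Rightarrow> nat \<Rightarrow> ratfun \<Rightarrow> ereal" where
  "deg_last F n a =
     (if a = 0 then - \<infinity>
      else ereal (real (Polynomial.degree
        (THE A. (\<forall>i. Polynomial.coeff A i \<in> ratfuns F (n - 1)) \<and> poly A (alpha n) = a))))"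

text \<open>Integer powers of an automorphism of \<open>K\<close>; outside \<open>K\<close> the function \<open>\<sigma>\<close> is unconstrained, so the inverse is
  taken relative to \<open>K\<close>.\<close>

definition auto_power :: "ratfun set \<Rightarrow> (ratfun \<Rightarrow> ratfun) \<Rightarrow> int \<Rightarrow> ratfun \<Rightarrow> ratfun" where
  "auto_power K \<sigma> k =
     (if 0 \<le> k then \<sigma> ^^ nat k else inv_into K \<sigma> ^^ nat (- k))"

definition Spr :: "complex set \<Rightarrow> nat \<Rightarrow> (ratfun \<Rightarrow> ratfun) \<Rightarrow> ratfun \<Rightarrow> ratfun \<Rightarrow> int set" where
  "Spr F n \<sigma> p q =
     {k. \<exists>c' \<in> F - {0}. auto_power (ratfuns F n) \<sigma> k p = const c' * q}"

definition shift_equiv ::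
    "complex set \<Rightarrow> nat \<Rightarrow> (ratfun \<Rightarrow> ratfun) \<Rightarrow> ratfun \<Rightarrow> ratfun \<Rightarrow> bool" where
  "shift_equiv F n \<sigma> p q \<longleftrightarrow> Spr F n \<sigma> p q \<noteq> {}"

definition csigma_summable ::
    "complex set \<Rightarrow> nat \<Rightarrow> complex \<Rightarrow> (ratfun \<Rightarrow> ratfun) \<Rightarrow> ratfun \<Rightarrow> bool" where
  "csigma_summable F n c \<sigma> f \<longleftrightarrow> (\<exists>g \<in> ratfuns F n. f = const c * \<sigma> g - g)"

end

theory Submission
  imports Defs
begin

text \<open>
  Write \<open>R\<close> for \<open>F[\<alpha>\<^sub>1,\<dots>,\<alpha>\<^sub>n]\<close> and \<open>R\<^sub>0\<close> for \<open>F[\<alpha>\<^sub>1,\<dots>,\<alpha>\<^sub>n\<^sub>-\<^sub>1]\<close>. The proof follows the denominator of a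
  solution along the \<open>\<sigma>\<close>-orbit \<open>d\<^sub>k = \<sigma>\<^sup>k d\<close> of \<open>d\<close>.

  The ring \<open>R\<close> is factorial, so \<open>d\<close> is prime in \<open>R\<close>. As \<open>\<sigma>\<close> restricts to an automorphism of \<open>R\<close>,
  every \<open>d\<^sub>k\<close> is prime, and \<open>Spr(d,d) = {0}\<close> says that no two of the \<open>d\<^sub>k\<close> are associated.
  If \<open>a \<noteq> 0\<close>, clearing denominators gives \<open>a = b/h\<close> with \<open>b \<in> R\<close> and \<open>h \<in> R\<^sub>0\<close>; by degree
  in \<open>\<alpha>\<^sub>n\<close> the prime \<open>d\<close> does not divide \<open>b\<close>, and no \<open>d\<^sub>k\<close> divides \<open>h\<close>.

  Suppose \<open>f = c \<sigma>(g) - g\<close> with \<open>g = P/Q\<close> in lowest terms. Then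
  \<open>b Q \<sigma>(Q) = h d\<^sup>j (c \<sigma>(P) Q - P \<sigma>(Q))\<close>. For \<open>k \<noteq> 0\<close> the prime \<open>d\<^sub>k\<close> does not divide
  \<open>h d\<^sup>j\<close>, so as soon as it divides one of \<open>Q\<close>, \<open>\<sigma>(Q)\<close> it divides
  \<open>c \<sigma>(P) Q - P \<sigma>(Q)\<close> and therefore, by coprimality, also the other one. Hence
  \<open>d\<^sub>k\<close> divides \<open>Q\<close> if and only if \<open>d\<^sub>k\<^sub>-\<^sub>1\<close> does. Going up from \<open>k = 0\<close> and down from
  \<open>k = -1\<close>, one divisor \<open>d\<^sub>k\<close> of \<open>Q\<close> would give infinitely many, which is impossible.
  So neither \<open>Q\<close> nor \<open>\<sigma>(Q)\<close> is divisible by \<open>d\<close>, although \<open>d\<close> divides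
  \<open>b Q \<sigma>(Q)\<close>: a contradiction. This is \<open>no_coprime_solution\<close> below.

  Factoriality of \<open>R\<close> (\<open>factorial_subring_polys\<close>) is proved by adjoining one variable at a time.
  Because \<open>F\<close> is a subset of the complex numbers, all rings here are subsets of a type that is
  an integral domain, and the notions of divisibility are relative to the subset.
\<close>

section \<open>Divisibility inside a subring of a domain\<close>

definition dvd_in :: "'a::idom set \<Rightarrow> 'a \<Rightarrow> 'a \<Rightarrow> bool" where
  "dvd_in R a b \<longleftrightarrow> (\<exists>c\<in>R. b = a * c)"

definition unit_in :: "'a::idom set \<Rightarrow> 'a \<Rightarrow> bool" where
  "unit_in R u \<longleftrightarrow> u \<in> R \<and> dvd_in R u 1"

definition irreducible_in :: "'a::idom set \<Rightarrow> 'a \<Rightarrow> bool" where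
  "irreducible_in R p \<longleftrightarrow> p \<in> R \<and> p \<noteq> 0 \<and> \<not> unit_in R p \<and>
     (\<forall>a\<in>R. \<forall>b\<in>R. p = a * b \<longrightarrow> unit_in R a \<or> unit_in R b)"

definition prime_in :: "'a::idom set \<Rightarrow> 'a \<Rightarrow> bool" where
  "prime_in R p \<longleftrightarrow> p \<in> R \<and> p \<noteq> 0 \<and> \<not> unit_in R p \<and>
     (\<forall>a\<in>R. \<forall>b\<in>R. dvd_in R p (a * b) \<longrightarrow> dvd_in R p a \<or> dvd_in R p b)"

definition polys_over :: "'a::idom set \<Rightarrow> 'a poly set" where
  "polys_over R = {A. \<forall>i. Polynomial.coeff A i \<in> R}"

locale unital_subring =
  fixes R :: "'a::idom set"
  assumes one_closed [simp, intro]: "1 \<in> R"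
    and diff_closed [intro]: "x \<in> R \<Longrightarrow> y \<in> R \<Longrightarrow> x - y \<in> R"
    and mult_closed [intro]: "x \<in> R \<Longrightarrow> y \<in> R \<Longrightarrow> x * y \<in> R"
begin

lemma zero_closed [simp, intro]: "0 \<in> R"
  using diff_closed[of 1 1] by simp

lemma uminus_closed [intro]: "x \<in> R \<Longrightarrow> - x \<in> R"
  using diff_closed[of 0 x] by simp

lemma add_closed [intro]: "x \<in> R \<Longrightarrow> y \<in> R \<Longrightarrow> x + y \<in> R"
  using diff_closed[of x "- y"] by auto

lemma sum_closed [intro]: "(\<And>i. i \<in> I \<Longrightarrow> g i \<in> R) \<Longrightarrow> sum g I \<in> R"
  by (induction I rule: infinite_finite_induct) auto

lemma power_closed [intro]: "x \<in> R \<Longrightarrow> x ^ k \<in> R"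
  by (induction k) auto

lemma dvd_in_self [simp, intro]: "dvd_in R a a"
  unfolding dvd_in_def by (rule bexI[of _ 1]) auto

lemma dvd_in_0 [simp, intro]: "dvd_in R a 0"
  unfolding dvd_in_def by (rule bexI[of _ 0]) auto

lemma dvd_in_trans: "dvd_in R a b \<Longrightarrow> dvd_in R b c \<Longrightarrow> dvd_in R a c"
  unfolding dvd_in_def using mult.assoc by (metis mult_closed)

lemma dvd_in_mult_right: "dvd_in R a b \<Longrightarrow> c \<in> R \<Longrightarrow> dvd_in R a (b * c)"
  unfolding dvd_in_def using mult.assoc by (metis mult_closed)

lemma dvd_in_mult_left: "dvd_in R a b \<Longrightarrow> c \<in> R \<Longrightarrow> dvd_in R a (c * b)"
  using dvd_in_mult_right by (metis mult.commute)

lemma dvd_in_diff: "dvd_in R a b \<Longrightarrow> dvd_in R a c \<Longrightarrow> dvd_in R a (b - c)"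
  unfolding dvd_in_def by (metis diff_closed right_diff_distrib)

lemma dvd_in_uminus: "dvd_in R a b \<Longrightarrow> dvd_in R a (- b)"
  using dvd_in_diff[of a 0 b] by simp

lemma dvd_in_add: "dvd_in R a b \<Longrightarrow> dvd_in R a c \<Longrightarrow> dvd_in R a (b + c)"
  using dvd_in_diff[of a b "- c"] dvd_in_uminus by simp

lemma prime_in_power:
  assumes "prime_in R p" "x \<in> R" "dvd_in R p (x ^ k)"
  shows "dvd_in R p x"
  using assms(3)
proof (induction k)
  case 0
  then show ?case using assms(1) by (auto simp: prime_in_def unit_in_def)
next
  case (Suc k)
  then show ?case using assms(1,2) power_closed[OF assms(2)] by (auto simp: prime_in_def)
qed

section \<open>Polynomials with coefficients in a subring\<close>

lemma unital_subring_polys_over: "unital_subring (polys_over R)"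
proof
  show "1 \<in> polys_over R"
    by (auto simp: polys_over_def coeff_1)
next
  fix A B assume "A \<in> polys_over R" "B \<in> polys_over R"
  then show "A - B \<in> polys_over R" "A * B \<in> polys_over R"
    by (auto simp: polys_over_def coeff_mult)
qed

lemma const_in_polys_over [simp]: "[:a:] \<in> polys_over R \<longleftrightarrow> a \<in> R"
  by (auto simp: polys_over_def coeff_pCons split: nat.splits)

lemma pCons_in_polys_over: "pCons a A \<in> polys_over R \<longleftrightarrow> a \<in> R \<and> A \<in> polys_over R"
  by (auto simp: polys_over_def coeff_pCons split: nat.splits)

lemma monom_in_polys_over: "a \<in> R \<Longrightarrow> Polynomial.monom a k \<in> polys_over R"
  by (auto simp: polys_over_def)

lemma smult_in_polys_over: "a \<in> R \<Longrightarrow> A \<in> polys_over R \<Longrightarrow> Polynomial.smult a A \<in> polys_over R"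
  by (auto simp: polys_over_def)

lemma lead_coeff_in: "A \<in> polys_over R \<Longrightarrow> lead_coeff A \<in> R"
  by (auto simp: polys_over_def)

lemma degree_0_in_polys_over:
  assumes "A \<in> polys_over R" "Polynomial.degree A = 0"
  obtains a where "A = [:a:]" "a \<in> R"
  using assms by (metis const_in_polys_over degree_eq_zeroE)

lemma unit_in_polys_over_iff: "unit_in (polys_over R) U \<longleftrightarrow> (\<exists>u. U = [:u:] \<and> unit_in R u)"
proof
  assume "unit_in (polys_over R) U"
  then obtain V where UV: "U \<in> polys_over R" "V \<in> polys_over R" "U * V = 1"
    by (auto simp: unit_in_def dvd_in_def)
  then have "U \<noteq> 0" "V \<noteq> 0" by auto
  then have "Polynomial.degree U + Polynomial.degree V = 0"
    using UV(3) degree_mult_eq[of U V] by simp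
  then obtain u v where uv: "U = [:u:]" "V = [:v:]" "u \<in> R" "v \<in> R"
    using UV degree_0_in_polys_over by (metis add_is_0)
  then have "u * v = 1" using UV(3) by (simp add: one_pCons mult.commute)
  then show "\<exists>u. U = [:u:] \<and> unit_in R u"
    using uv unfolding unit_in_def dvd_in_def by metis
next
  assume "\<exists>u. U = [:u:] \<and> unit_in R u"
  then obtain u v where "U = [:u:]" "u \<in> R" "v \<in> R" "u * v = 1"
    by (auto simp: unit_in_def dvd_in_def)
  then show "unit_in (polys_over R) U"
    unfolding unit_in_def dvd_in_def
    by (auto intro!: bexI[of _ "[:v:]"] simp: one_pCons)
qed

lemma dvd_in_const_pCons:
  "dvd_in (polys_over R) [:p:] (pCons a A) \<longleftrightarrow> dvd_in R p a \<and> dvd_in (polys_over R) [:p:] A"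
proof
  assume "dvd_in (polys_over R) [:p:] (pCons a A)"
  then obtain C where C: "C \<in> polys_over R" "pCons a A = Polynomial.smult p C"
    by (auto simp: dvd_in_def)
  obtain c C' where "C = pCons c C'" by (cases C)
  then show "dvd_in R p a \<and> dvd_in (polys_over R) [:p:] A"
    using C by (auto simp: dvd_in_def pCons_in_polys_over)
next
  assume "dvd_in R p a \<and> dvd_in (polys_over R) [:p:] A"
  then obtain c C where "c \<in> R" "a = p * c" "C \<in> polys_over R" "A = Polynomial.smult p C"
    by (auto simp: dvd_in_def)
  then show "dvd_in (polys_over R) [:p:] (pCons a A)"
    unfolding dvd_in_def by (auto intro!: bexI[of _ "pCons c C"] simp: pCons_in_polys_over)
qed

text \<open>
  Strip the constant coefficients one by one. If \<open>p\<close> divides the constant coefficient of the left factor, that coefficient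
  can be dropped; otherwise \<open>p\<close> divides every coefficient of the right factor, from the constant one
  upwards.
\<close>

lemma prime_in_const:
  assumes p: "prime_in R p"
  shows "prime_in (polys_over R) [:p:]"
proof -
  interpret P: unital_subring "polys_over R" by (rule unital_subring_polys_over)
  let ?dvd = "dvd_in (polys_over R) [:p:]"
  have pR: "p \<in> R" and p0: "p \<noteq> 0" using p by (auto simp: prime_in_def)
  have nunit: "\<not> unit_in (polys_over R) [:p:]"
    using p by (auto simp: unit_in_polys_over_iff prime_in_def)
  \<comment> \<open>If \<open>p\<close> does not divide the constant coefficient of the left factor, the coefficients of the
     right factor are cleared one after the other.\<close>
  have right: "?dvd B" if "?dvd (pCons a A * B)" "\<not> dvd_in R p a" "a \<in> R" "A \<in> polys_over R"
    "B \<in> polys_over R" for a A B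
    using that(5,1)
  proof (induction B)
    case 0
    then show ?case by simp
  next
    case (pCons b B)
    have *: "b \<in> R" "B \<in> polys_over R"
      using pCons.prems(1) by (auto simp: pCons_in_polys_over)
    have "pCons a A * pCons b B =
        pCons (a * b) (Polynomial.smult b A + pCons a A * B)"
      by (simp add: algebra_simps)
    then have "?dvd (pCons (a * b) (Polynomial.smult b A + pCons a A * B))"
      using pCons.prems(2) by (simp only:)
    then have d: "dvd_in R p (a * b)" "?dvd (Polynomial.smult b A + pCons a A * B)"
      unfolding dvd_in_const_pCons by (rule conjunct1, rule conjunct2)
    from d(1) have pb: "dvd_in R p b"
      using p that(2,3) * by (auto simp: prime_in_def)
    then have "?dvd [:b:]"
      using dvd_in_const_pCons[of p b 0] by simp
    then have "?dvd (Polynomial.smult b A)"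
      using P.dvd_in_mult_right[of _ "[:b:]" A] that(4) by simp
    then have "?dvd (pCons a A * B)"
      using P.dvd_in_diff[OF d(2)] by fastforce
    then show ?case using pCons.IH * pb dvd_in_const_pCons by blast
  qed
  have "?dvd A \<or> ?dvd B" if "?dvd (A * B)" "A \<in> polys_over R" "B \<in> polys_over R" for A B
    using that
  proof (induction A)
    case 0
    then show ?case by simp
  next
    case (pCons a A)
    have *: "a \<in> R" "A \<in> polys_over R"
      using pCons.prems(2) by (auto simp: pCons_in_polys_over)
    show ?case
    proof (cases "dvd_in R p a")
      case True
      then have "?dvd [:a:]"
        using dvd_in_const_pCons[of p a 0] by simp
      then have "?dvd (Polynomial.smult a B)"
        using P.dvd_in_mult_right[of _ "[:a:]" B] pCons.prems(3) by simp
      moreover have "pCons a A * B = Polynomial.smult a B + pCons 0 (A * B)"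
        by simp
      ultimately have "?dvd (pCons 0 (A * B))"
        using P.dvd_in_diff[OF pCons.prems(1)] by fastforce
      then have "?dvd (A * B)" using dvd_in_const_pCons by blast
      then show ?thesis
        using pCons.IH * pCons.prems(3) True dvd_in_const_pCons by blast
    next
      case False
      then show ?thesis using right pCons.prems * by blast
    qed
  qed
  then show ?thesis
    using nunit pR p0 unfolding prime_in_def by auto
qed

text \<open>
  Division with remainder needs an invertible leading coefficient; multiplying the dividend by a power
  of the leading coefficient of the divisor removes that need.
\<close>

lemma pseudo_division:
  assumes H: "H \<in> polys_over R" "H \<noteq> 0"
    and A: "A \<in> polys_over R"
  shows "\<exists>s\<in>R - {0}. \<exists>Q\<in>polys_over R. \<exists>T\<in>polys_over R.
    Polynomial.smult s A = Q * H + T \<and> (T = 0 \<or> Polynomial.degree T < Polynomial.degree H)"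
  using A
proof (induction "Polynomial.degree A" arbitrary: A rule: less_induct)
  case less
  interpret P: unital_subring "polys_over R" by (rule unital_subring_polys_over)
  show ?case
  proof (cases "A = 0 \<or> Polynomial.degree A < Polynomial.degree H")
    case True
    then show ?thesis using less.prems
      by (intro bexI[of _ 1] bexI[of _ 0] bexI[of _ A]) auto
  next
    case False
    then have A0: "A \<noteq> 0" and le: "Polynomial.degree H \<le> Polynomial.degree A" by auto
    define M where "M = Polynomial.monom (lead_coeff A) (Polynomial.degree A - Polynomial.degree H)"
    define A' where "A' = Polynomial.smult (lead_coeff H) A - M * H"
    have M: "M \<in> polys_over R"
      unfolding M_def using less.prems by (intro monom_in_polys_over lead_coeff_in)
    have hR: "lead_coeff H \<in> R" and h0: "lead_coeff H \<noteq> 0"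
      using H lead_coeff_in by auto
    have A': "A' \<in> polys_over R"
      unfolding A'_def using M H(1) less.prems hR smult_in_polys_over by blast
    have "M \<noteq> 0" using A0 by (simp add: M_def)
    moreover have "Polynomial.degree M = Polynomial.degree A - Polynomial.degree H"
      using A0 by (simp add: M_def degree_monom_eq)
    ultimately have degM: "Polynomial.degree (M * H) = Polynomial.degree A"
      using degree_mult_eq[of M H] H(2) le by simp
    have "Polynomial.degree A' \<le> Polynomial.degree A"
      unfolding A'_def using degM h0 by (intro degree_diff_le) auto
    moreover have "lead_coeff (M * H) = lead_coeff A * lead_coeff H"
      by (simp only: lead_coeff_mult M_def lead_coeff_monom)
    then have "Polynomial.coeff A' (Polynomial.degree A) = 0"
      unfolding A'_def using degM by simp
    ultimately have deg: "A' = 0 \<or> Polynomial.degree A' < Polynomial.degree A"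
      by (metis eq_zero_or_degree_less)
    have "\<exists>s\<in>R - {0}. \<exists>Q\<in>polys_over R. \<exists>T\<in>polys_over R.
      Polynomial.smult s A' = Q * H + T \<and> (T = 0 \<or> Polynomial.degree T < Polynomial.degree H)"
    proof (cases "A' = 0")
      case True
      then show ?thesis by (intro bexI[of _ 1] bexI[of _ 0]) auto
    next
      case False
      then show ?thesis using deg less.hyps A' by blast
    qed
    then obtain s Q T where sQT: "s \<in> R" "s \<noteq> 0" "Q \<in> polys_over R" "T \<in> polys_over R"
      "Polynomial.smult s A' = Q * H + T" "T = 0 \<or> Polynomial.degree T < Polynomial.degree H"
      by blast
    have "Polynomial.smult (s * lead_coeff H) A = (Q + Polynomial.smult s M) * H + T"
      using sQT(5) unfolding A'_def by (simp add: algebra_simps smult_diff_right)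
    moreover have "s * lead_coeff H \<in> R - {0}" using sQT hR h0 by auto
    moreover have "Q + Polynomial.smult s M \<in> polys_over R"
      using sQT M smult_in_polys_over by blast
    ultimately show ?thesis using sQT(4,6) by blast
  qed
qed

end

text \<open>
  The additive size that vanishes only on units replaces existence of factorizations: it bounds the
  number of prime factors and passes to polynomials as degree plus size of the leading coefficient.
\<close>

locale factorial_subring = unital_subring R for R :: "'a::idom set" +
  assumes size_exists: "\<exists>\<mu> :: 'a \<Rightarrow> nat. (\<forall>x\<in>R - {0}. \<forall>y\<in>R - {0}. \<mu> (x * y) = \<mu> x + \<mu> y)
        \<and> (\<forall>x\<in>R - {0}. \<mu> x = 0 \<longrightarrow> unit_in R x)"
    and irreducible_imp_prime: "irreducible_in R p \<Longrightarrow> prime_in R p"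
begin

definition size_in :: "'a \<Rightarrow> nat" where
  "size_in = (SOME \<mu>. (\<forall>x\<in>R - {0}. \<forall>y\<in>R - {0}. \<mu> (x * y) = \<mu> x + \<mu> y)
        \<and> (\<forall>x\<in>R - {0}. \<mu> x = 0 \<longrightarrow> unit_in R x))"

lemma size_in_mult:
  "x \<in> R \<Longrightarrow> y \<in> R \<Longrightarrow> x \<noteq> 0 \<Longrightarrow> y \<noteq> 0 \<Longrightarrow> size_in (x * y) = size_in x + size_in y"
  and size_in_0: "x \<in> R \<Longrightarrow> x \<noteq> 0 \<Longrightarrow> size_in x = 0 \<Longrightarrow> unit_in R x"
  using someI_ex[OF size_exists] unfolding size_in_def[symmetric] by auto

lemma size_in_less:
  assumes "x \<in> R" "y \<in> R" "x * y \<noteq> 0" "\<not> unit_in R x"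
  shows "size_in y < size_in (x * y)"
  using assms size_in_mult[of x y] size_in_0[of x] by fastforce

lemma prime_factor_exists:
  assumes "x \<in> R" "x \<noteq> 0" "\<not> unit_in R x"
  shows "\<exists>p. prime_in R p \<and> dvd_in R p x"
  using assms
proof (induction "size_in x" arbitrary: x rule: less_induct)
  case less
  show ?case
  proof (cases "irreducible_in R x")
    case True
    then show ?thesis using irreducible_imp_prime by blast
  next
    case False
    then obtain a b where ab: "a \<in> R" "b \<in> R" "x = a * b" "\<not> unit_in R a" "\<not> unit_in R b"
      using less.prems by (auto simp: irreducible_in_def)
    then have "size_in b < size_in x" "b \<noteq> 0"
      using size_in_less[of a b] less.prems by auto
    then obtain p where "prime_in R p" "dvd_in R p b"
      using less.hyps[of b] ab by blast
    then show ?thesis using dvd_in_mult_left ab by blast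
  qed
qed

text \<open>
  Induction along a factorization into primes, which exists because splitting off a prime lowers the size.
\<close>

lemma nonzero_induct [consumes 2, case_names unit prime_mult]:
  assumes "x \<in> R" "x \<noteq> 0"
    and unit: "\<And>u. unit_in R u \<Longrightarrow> Pr u"
    and prime_mult: "\<And>p y. prime_in R p \<Longrightarrow> y \<in> R \<Longrightarrow> y \<noteq> 0 \<Longrightarrow> Pr y \<Longrightarrow> Pr (p * y)"
  shows "Pr x"
  using assms(1,2)
proof (induction "size_in x" arbitrary: x rule: less_induct)
  case less
  show ?case
  proof (cases "unit_in R x")
    case True
    then show ?thesis by (rule unit)
  next
    case False
    then obtain p y where p: "prime_in R p" "y \<in> R" "x = p * y"
      using prime_factor_exists less.prems by (meson dvd_in_def)
    then have "size_in y < size_in x" "y \<noteq> 0"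
      using size_in_less[of p y] less.prems by (auto simp: prime_in_def)
    then show ?thesis using p less.hyps prime_mult by blast
  qed
qed

text \<open>
  The primes of a scalar remain prime in the polynomial ring. If none of them divides \<open>D\<close>, they all divide the
  cofactor of \<open>D\<close> and can be cancelled.
\<close>

lemma primitive_dvd_smult:
  assumes "s \<in> R" "s \<noteq> 0" and D: "D \<in> polys_over R"
    and prim: "\<And>p. prime_in R p \<Longrightarrow> \<not> dvd_in (polys_over R) [:p:] D"
    and "B \<in> polys_over R" and "dvd_in (polys_over R) D (Polynomial.smult s B)"
  shows "dvd_in (polys_over R) D B"
  using assms(1,2,5,6)
proof (induction s arbitrary: B rule: nonzero_induct)
  case (unit u)
  interpret P: unital_subring "polys_over R" by (rule unital_subring_polys_over)
  from unit obtain v where "v \<in> R" "u * v = 1" by (auto simp: unit_in_def dvd_in_def)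
  moreover have "dvd_in (polys_over R) D (Polynomial.smult u B * [:v:])"
    using unit \<open>v \<in> R\<close> by (intro P.dvd_in_mult_right) simp_all
  moreover have "Polynomial.smult u B * [:v:] = B"
    using \<open>u * v = 1\<close> by (simp add: mult.commute[of v])
  ultimately show ?case by simp
next
  case (prime_mult p y)
  have pc: "prime_in (polys_over R) [:p:]" using prime_in_const prime_mult by blast
  from prime_mult obtain W where W: "W \<in> polys_over R" "Polynomial.smult (p * y) B = D * W"
    by (auto simp: dvd_in_def)
  have "D * W = [:p:] * Polynomial.smult y B" by (simp add: mult.commute[of p] flip: W(2))
  moreover have "Polynomial.smult y B \<in> polys_over R"
    using prime_mult smult_in_polys_over by blast
  ultimately have "dvd_in (polys_over R) [:p:] (D * W)"
    unfolding dvd_in_def by blast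
  then have "dvd_in (polys_over R) [:p:] W"
    using pc prim[OF prime_mult(1)] D W(1) by (auto simp: prime_in_def)
  then obtain W' where W': "W' \<in> polys_over R" "W = [:p:] * W'"
    by (auto simp: dvd_in_def)
  have "[:p:] * Polynomial.smult y B = [:p:] * (D * W')"
    using W W' by (simp add: mult.commute)
  then have "Polynomial.smult y B = D * W'"
    using pc by (simp only: mult_cancel_left) (auto simp: prime_in_def)
  then show ?case using prime_mult W' by (auto simp: dvd_in_def)
qed

text \<open>
  Gauss's lemma: each prime of the scalar \<open>s\<close> divides one of the two factors, and is cancelled there.
\<close>

lemma split_scalar:
  assumes "s \<in> R" "s \<noteq> 0" and D: "D \<in> polys_over R"
    and "Q \<in> polys_over R" "H \<in> polys_over R" and "Polynomial.smult s D = Q * H"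
  shows "\<exists>s1\<in>R. \<exists>s2\<in>R. \<exists>Q'\<in>polys_over R. \<exists>H'\<in>polys_over R.
    Q = Polynomial.smult s1 Q' \<and> H = Polynomial.smult s2 H' \<and> D = Q' * H'"
  using assms(1,2,4,5,6)
proof (induction s arbitrary: Q H rule: nonzero_induct)
  case (unit u)
  then obtain v where v: "u \<in> R" "v \<in> R" "u * v = 1" by (auto simp: unit_in_def dvd_in_def)
  have "D = Polynomial.smult v (Polynomial.smult u D)"
    using v by (simp add: mult.commute)
  also have "\<dots> = Polynomial.smult v Q * H" using unit.prems(3) by simp
  finally have "D = Polynomial.smult v Q * H" .
  moreover have "Q = Polynomial.smult u (Polynomial.smult v Q)" using v by simp
  moreover have "H = Polynomial.smult 1 H" by simp
  ultimately show ?case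
    using v(1) smult_in_polys_over[OF v(2) unit.prems(1)] unit.prems(2) one_closed by blast
next
  case (prime_mult p y)
  have pc: "prime_in (polys_over R) [:p:]" and p0: "p \<noteq> 0" and pR: "p \<in> R"
    using prime_in_const prime_mult by (auto simp: prime_in_def)
  have QH: "Q * H = [:p:] * Polynomial.smult y D" unfolding prime_mult.prems(3)[symmetric]
    by (simp add: mult.commute)
  then have "dvd_in (polys_over R) [:p:] (Q * H)"
    using smult_in_polys_over[OF prime_mult(2) D] unfolding dvd_in_def by blast
  then consider "dvd_in (polys_over R) [:p:] Q" | "dvd_in (polys_over R) [:p:] H"
    using pc prime_mult.prems(1,2) unfolding prime_in_def by blast
  then show ?case
  proof cases
    case 1
    then obtain Q1 where Q1: "Q1 \<in> polys_over R" "Q = Polynomial.smult p Q1"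
      by (auto simp: dvd_in_def)
    have "[:p:] * Polynomial.smult y D = [:p:] * (Q1 * H)" using QH Q1 by simp
    then have yD: "Polynomial.smult y D = Q1 * H"
      using p0 by (simp only: mult_cancel_left) auto
    obtain s1 s2 Q' H' where "s1 \<in> R" "s2 \<in> R" "Q' \<in> polys_over R" "H' \<in> polys_over R"
      "Q1 = Polynomial.smult s1 Q'" "H = Polynomial.smult s2 H'" "D = Q' * H'"
      using prime_mult.IH[OF Q1(1) prime_mult.prems(2) yD] by blast
    moreover from this have "Q = Polynomial.smult (p * s1) Q'" using Q1 by simp
    ultimately show ?thesis using pR mult_closed by blast
  next
    case 2
    then obtain H1 where H1: "H1 \<in> polys_over R" "H = Polynomial.smult p H1"
      by (auto simp: dvd_in_def)
    have "[:p:] * Polynomial.smult y D = [:p:] * (Q * H1)" using QH H1 by simp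
    then have yD: "Polynomial.smult y D = Q * H1"
      using p0 by (simp only: mult_cancel_left) auto
    obtain s1 s2 Q' H' where "s1 \<in> R" "s2 \<in> R" "Q' \<in> polys_over R" "H' \<in> polys_over R"
      "Q = Polynomial.smult s1 Q'" "H1 = Polynomial.smult s2 H'" "D = Q' * H'"
      using prime_mult.IH[OF prime_mult.prems(1) H1(1) yD] by blast
    moreover from this have "H = Polynomial.smult (p * s2) H'" using H1 by simp
    ultimately show ?thesis using pR mult_closed by blast
  qed
qed

lemma irreducible_const_prime:
  assumes D: "irreducible_in (polys_over R) D" and deg: "Polynomial.degree D = 0"
  shows "prime_in (polys_over R) D"
proof -
  have "D \<in> polys_over R" using D by (simp add: irreducible_in_def)
  then obtain p where p: "D = [:p:]" "p \<in> R"
    using deg by (rule degree_0_in_polys_over)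
  have "irreducible_in R p"
    unfolding irreducible_in_def
  proof (intro conjI ballI impI)
    show "p \<noteq> 0" "\<not> unit_in R p"
      using D p by (auto simp: irreducible_in_def unit_in_polys_over_iff)
    fix a b assume ab: "a \<in> R" "b \<in> R" "p = a * b"
    then have "D = [:a:] * [:b:]" using p by simp
    moreover have "[:a:] \<in> polys_over R" "[:b:] \<in> polys_over R" using ab by auto
    ultimately have "unit_in (polys_over R) [:a:] \<or> unit_in (polys_over R) [:b:]"
      using D by (auto simp: irreducible_in_def)
    then show "unit_in R a \<or> unit_in R b"
      by (auto simp: unit_in_polys_over_iff)
  qed (use p in auto)
  then show ?thesis using p prime_in_const irreducible_imp_prime by blast
qed

lemma irreducible_nonconst_primitive:
  assumes D: "irreducible_in (polys_over R) D" and deg: "Polynomial.degree D > 0"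
    and p: "prime_in R p"
  shows "\<not> dvd_in (polys_over R) [:p:] D"
proof
  assume "dvd_in (polys_over R) [:p:] D"
  then obtain E where E: "E \<in> polys_over R" "D = [:p:] * E" by (auto simp: dvd_in_def)
  moreover have "[:p:] \<in> polys_over R" using p by (simp add: prime_in_def)
  ultimately have "unit_in (polys_over R) [:p:] \<or> unit_in (polys_over R) E"
    using D unfolding irreducible_in_def by blast
  moreover have "\<not> unit_in (polys_over R) [:p:]"
    using p by (simp add: unit_in_polys_over_iff prime_in_def)
  ultimately obtain u where "E = [:u:]" unfolding unit_in_polys_over_iff by blast
  then show False using E(2) deg by simp
qed

text \<open>
  Let \<open>H\<close> be a nonzero element of least degree in the ideal generated by \<open>D\<close> and \<open>A\<close>. Then \<open>H\<close> divides
  a scalar multiple of \<open>D\<close> and one of \<open>A\<close>. By Gauss's lemma and irreducibility of \<open>D\<close>, it is, up to a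
  scalar factor, a unit or associated to \<open>D\<close>. In the first case a scalar lies in the ideal, so \<open>D\<close> divides a scalar multiple of \<open>B\<close>;
  in the second \<open>D\<close> divides a scalar multiple of \<open>A\<close>. The scalar is removed because \<open>D\<close> is primitive.
\<close>

lemma irreducible_nonconst_prime:
  assumes D: "irreducible_in (polys_over R) D" and deg: "Polynomial.degree D > 0"
  shows "prime_in (polys_over R) D"
  unfolding prime_in_def
proof (intro conjI ballI impI)
  interpret P: unital_subring "polys_over R" by (rule unital_subring_polys_over)
  let ?dvd = "dvd_in (polys_over R) D"
  show DR: "D \<in> polys_over R" and D0: "D \<noteq> 0" and Dnu: "\<not> unit_in (polys_over R) D"
    using D by (auto simp: irreducible_in_def)
  note prim = irreducible_nonconst_primitive[OF D deg]
  fix A B assume AB: "A \<in> polys_over R" "B \<in> polys_over R" "?dvd (A * B)"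
  define I where "I = {U * D + V * A | U V. U \<in> polys_over R \<and> V \<in> polys_over R}"
  have "D = 1 * D + 0 * A" "A = 0 * D + 1 * A" by auto
  then have DI: "D \<in> I" and AI: "A \<in> I" unfolding I_def by blast+
  obtain H where H: "H \<in> I" "H \<noteq> 0"
    and min: "\<And>G. G \<in> I \<Longrightarrow> G \<noteq> 0 \<Longrightarrow> Polynomial.degree H \<le> Polynomial.degree G"
    using ex_has_least_nat[of "\<lambda>G. G \<in> I \<and> G \<noteq> 0" D Polynomial.degree] DI D0 by blast
  obtain U V where UV: "U \<in> polys_over R" "V \<in> polys_over R" "H = U * D + V * A"
    using H by (auto simp: I_def)
  have HR: "H \<in> polys_over R" using UV DR AB by blast
  \<comment> \<open>By minimality, a pseudo-remainder modulo \<open>H\<close> vanishes: \<open>H\<close> generates \<open>I\<close> up to scalars.\<close>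
  have gen: "\<exists>s\<in>R - {0}. \<exists>Q\<in>polys_over R. Polynomial.smult s G = Q * H" if G: "G \<in> I" for G
  proof -
    from G obtain U' V' where G': "U' \<in> polys_over R" "V' \<in> polys_over R" "G = U' * D + V' * A"
      by (auto simp: I_def)
    then have "G \<in> polys_over R" using DR AB by blast
    then obtain s Q T where s: "s \<in> R - {0}" "Q \<in> polys_over R" "T \<in> polys_over R"
      "Polynomial.smult s G = Q * H + T" "T = 0 \<or> Polynomial.degree T < Polynomial.degree H"
      using pseudo_division[OF HR H(2)] by blast
    have "T = Polynomial.smult s G - Q * H" using s(4) by simp
    also have "\<dots> = (Polynomial.smult s U' - Q * U) * D + (Polynomial.smult s V' - Q * V) * A"
      unfolding UV(3) G'(3) by (simp add: algebra_simps smult_add_right)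
    finally have "T = (Polynomial.smult s U' - Q * U) * D + (Polynomial.smult s V' - Q * V) * A" .
    moreover have "Polynomial.smult s U' - Q * U \<in> polys_over R"
      "Polynomial.smult s V' - Q * V \<in> polys_over R"
      using s G' UV smult_in_polys_over by blast+
    ultimately have "T \<in> I" unfolding I_def by blast
    then have "T = 0" using s(5) min by force
    then show ?thesis using s by auto
  qed
  obtain s Q where s: "s \<in> R" "s \<noteq> 0" "Q \<in> polys_over R" "Polynomial.smult s D = Q * H"
    using gen[OF DI] by blast
  obtain s1 s2 Q' H' where fac: "s1 \<in> R" "s2 \<in> R" "Q' \<in> polys_over R" "H' \<in> polys_over R"
    "Q = Polynomial.smult s1 Q'" "H = Polynomial.smult s2 H'" "D = Q' * H'"
    using split_scalar[OF s(1,2) DR s(3) HR s(4)] by blast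
  have "unit_in (polys_over R) Q' \<or> unit_in (polys_over R) H'"
    using D fac(3,4,7) unfolding irreducible_in_def by blast
  then show "?dvd A \<or> ?dvd B"
  proof
    assume "unit_in (polys_over R) H'"
    then obtain u where u: "H' = [:u:]" "u \<in> R"
      unfolding unit_in_polys_over_iff by (auto simp: unit_in_def)
    define h where "h = s2 * u"
    have h: "H = [:h:]" "h \<in> R" "h \<noteq> 0" using fac u H(2) unfolding h_def by auto
    have "Polynomial.smult h B = H * B" using h by simp
    also have "\<dots> = D * (U * B) + V * (A * B)" unfolding UV(3) by (simp only: algebra_simps)
    finally have "Polynomial.smult h B = D * (U * B) + V * (A * B)" .
    moreover have "?dvd (D * (U * B) + V * (A * B))"
      using P.dvd_in_add[OF P.dvd_in_mult_right[OF P.dvd_in_self] P.dvd_in_mult_left[OF AB(3) UV(2)]]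
        P.mult_closed[OF UV(1) AB(2)] by blast
    ultimately have "?dvd (Polynomial.smult h B)" by simp
    then have "?dvd B"
      using primitive_dvd_smult[OF h(2,3) DR prim AB(2)] by blast
    then show ?thesis ..
  next
    assume "unit_in (polys_over R) Q'"
    then obtain W where W: "W \<in> polys_over R" "Q' * W = 1" by (auto simp: unit_in_def dvd_in_def)
    have "H' = (Q' * W) * H'" using W(2) by simp
    also have "\<dots> = D * W" unfolding fac(7) by (simp only: ac_simps)
    finally have "H = D * Polynomial.smult s2 W" unfolding fac(6) by simp
    then have DH: "?dvd H"
      unfolding dvd_in_def using W fac(2) smult_in_polys_over by blast
    obtain t Q2 where t: "t \<in> R" "t \<noteq> 0" "Q2 \<in> polys_over R" "Polynomial.smult t A = Q2 * H"
      using gen[OF AI] by blast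
    have "?dvd (Polynomial.smult t A)" using t P.dvd_in_mult_left[OF DH] by simp
    then have "?dvd A"
      using primitive_dvd_smult[OF t(1,2) DR prim AB(1)] by blast
    then show ?thesis ..
  qed
qed

theorem factorial_subring_polys_over: "factorial_subring (polys_over R)"
proof -
  interpret P: unital_subring "polys_over R" by (rule unital_subring_polys_over)
  let ?size = "\<lambda>A. Polynomial.degree A + size_in (lead_coeff A)"
  have "?size (A * B) = ?size A + ?size B"
    if "A \<in> polys_over R - {0}" "B \<in> polys_over R - {0}" for A B
  proof -
    have "size_in (lead_coeff (A * B)) = size_in (lead_coeff A) + size_in (lead_coeff B)"
      unfolding lead_coeff_mult using that lead_coeff_in by (intro size_in_mult) auto
    moreover have "Polynomial.degree (A * B) = Polynomial.degree A + Polynomial.degree B"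
      using that by (intro degree_mult_eq) auto
    ultimately show ?thesis by linarith
  qed
  moreover have "unit_in (polys_over R) A" if "A \<in> polys_over R - {0}" "?size A = 0" for A
  proof -
    have "A \<in> polys_over R" "Polynomial.degree A = 0" using that by auto
    then obtain a where "A = [:a:]" "a \<in> R" by (rule degree_0_in_polys_over)
    then show ?thesis using that size_in_0[of a] by (auto simp: unit_in_polys_over_iff)
  qed
  ultimately have "\<exists>\<mu> :: 'a poly \<Rightarrow> nat.
      (\<forall>x\<in>polys_over R - {0}. \<forall>y\<in>polys_over R - {0}. \<mu> (x * y) = \<mu> x + \<mu> y) \<and>
      (\<forall>x\<in>polys_over R - {0}. \<mu> x = 0 \<longrightarrow> unit_in (polys_over R) x)"
    by (intro exI[of _ ?size] conjI ballI impI)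
  then show ?thesis
    using irreducible_const_prime irreducible_nonconst_prime
    by (intro factorial_subring.intro factorial_subring_axioms.intro P.unital_subring_axioms) auto
qed

end

section \<open>Factoriality of multivariate polynomial rings\<close>

locale ring_embedding = unital_subring R for R :: "'a::idom set" +
  fixes \<phi> :: "'a \<Rightarrow> 'b::idom"
  assumes hom_one: "\<phi> 1 = 1"
    and hom_diff: "x \<in> R \<Longrightarrow> y \<in> R \<Longrightarrow> \<phi> (x - y) = \<phi> x - \<phi> y"
    and hom_mult: "x \<in> R \<Longrightarrow> y \<in> R \<Longrightarrow> \<phi> (x * y) = \<phi> x * \<phi> y"
    and hom_inj: "inj_on \<phi> R"
begin

lemma hom_zero: "\<phi> 0 = 0"
  using hom_diff[of 1 1] by simp

lemma hom_eq_iff: "x \<in> R \<Longrightarrow> y \<in> R \<Longrightarrow> \<phi> x = \<phi> y \<longleftrightarrow> x = y"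
  using hom_inj by (auto simp: inj_on_def)

lemma hom_eq_0_iff: "x \<in> R \<Longrightarrow> \<phi> x = 0 \<longleftrightarrow> x = 0"
  using hom_eq_iff[of x 0] hom_zero by simp

lemma dvd_in_image: "a \<in> R \<Longrightarrow> b \<in> R \<Longrightarrow> dvd_in (\<phi> ` R) (\<phi> a) (\<phi> b) \<longleftrightarrow> dvd_in R a b"
  by (auto simp: dvd_in_def hom_eq_iff mult_closed simp flip: hom_mult)

lemma unit_in_image: "u \<in> R \<Longrightarrow> unit_in (\<phi> ` R) (\<phi> u) \<longleftrightarrow> unit_in R u"
  using dvd_in_image[of u 1] by (simp add: unit_in_def hom_one)

lemma irreducible_in_image:
  "p \<in> R \<Longrightarrow> irreducible_in (\<phi> ` R) (\<phi> p) \<longleftrightarrow> irreducible_in R p"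
  by (auto simp: irreducible_in_def unit_in_image hom_eq_0_iff hom_eq_iff mult_closed
      simp flip: hom_mult)

lemma prime_in_image: "p \<in> R \<Longrightarrow> prime_in (\<phi> ` R) (\<phi> p) \<longleftrightarrow> prime_in R p"
  by (auto simp: prime_in_def unit_in_image hom_eq_0_iff dvd_in_image mult_closed
      simp flip: hom_mult)

lemma unital_subring_image: "unital_subring (\<phi> ` R)"
  using hom_one one_closed
  by unfold_locales (auto simp: image_iff simp flip: hom_mult hom_diff, (metis one_closed)?)

end

lemma factorial_subring_image:
  assumes "factorial_subring R" and "ring_embedding R \<phi>"
  shows "factorial_subring (\<phi> ` R)"
proof -
  interpret factorial_subring R by fact
  interpret ring_embedding R \<phi> by fact
  let ?size = "\<lambda>y. size_in (the_inv_into R \<phi> y)"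
  have inv: "the_inv_into R \<phi> (\<phi> x) = x" if "x \<in> R" for x
    using that hom_inj by (rule the_inv_into_f_f[rotated])
  have 1: "?size (x * y) = ?size x + ?size y" if "x \<in> \<phi> ` R - {0}" "y \<in> \<phi> ` R - {0}" for x y
  proof -
    from that obtain x' y' where "x' \<in> R" "y' \<in> R" "x = \<phi> x'" "y = \<phi> y'" by blast
    moreover from this that have "x' \<noteq> 0" "y' \<noteq> 0" by (auto simp: hom_zero)
    ultimately show ?thesis
      by (simp add: inv mult_closed size_in_mult flip: hom_mult)
  qed
  have 2: "unit_in (\<phi> ` R) x" if "x \<in> \<phi> ` R - {0}" "?size x = 0" for x
  proof -
    from that obtain x' where "x' \<in> R" "x = \<phi> x'" by blast
    moreover from this that have "x' \<noteq> 0" "size_in x' = 0" by (auto simp: hom_zero inv)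
    ultimately show ?thesis by (simp add: size_in_0 unit_in_image)
  qed
  have "\<exists>\<mu> :: 'b \<Rightarrow> nat.
      (\<forall>x\<in>\<phi> ` R - {0}. \<forall>y\<in>\<phi> ` R - {0}. \<mu> (x * y) = \<mu> x + \<mu> y) \<and>
      (\<forall>x\<in>\<phi> ` R - {0}. \<mu> x = 0 \<longrightarrow> unit_in (\<phi> ` R) x)"
    using 1 2 by (intro exI[of _ ?size] conjI ballI impI)
  moreover have "prime_in (\<phi> ` R) p" if "irreducible_in (\<phi> ` R) p" for p
  proof -
    have "p \<in> \<phi> ` R" using that by (simp add: irreducible_in_def)
    then obtain p' where p': "p' \<in> R" "p = \<phi> p'" by blast
    then have "irreducible_in R p'" using that irreducible_in_image by simp
    then show ?thesis using p' irreducible_imp_prime prime_in_image by simp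
  qed
  ultimately show ?thesis
    by (intro factorial_subring.intro factorial_subring_axioms.intro unital_subring_image) auto
qed

definition mpolys :: "complex set \<Rightarrow> nat \<Rightarrow> mpoly set" where
  "mpolys F n = {p. (\<forall>m. Poly_Mapping.lookup p m \<in> F) \<and>
      (\<forall>m \<in> Poly_Mapping.keys p. Poly_Mapping.keys m \<subseteq> {1..n})}"

lemma poly_mapping_eq_sum_single:
  "p = (\<Sum>m\<in>Poly_Mapping.keys p. Poly_Mapping.single m (Poly_Mapping.lookup p m))"
  by (rule poly_mapping_eqI)
    (auto simp: lookup_sum lookup_single when_def in_keys_iff)

lemma single_var_power:
  "Poly_Mapping.single (Poly_Mapping.single i (1::nat)) (1::complex) ^ e
     = Poly_Mapping.single (Poly_Mapping.single i e) 1"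
  by (induction e) (simp_all add: mult_single flip: single_add single_one)

lemma to_fract_pow: "to_fract (x ^ e) = to_fract x ^ e"
  by (induction e) simp_all

lemma lookup_times_single_shift:
  fixes p :: mpoly
  shows "Poly_Mapping.lookup (p * Poly_Mapping.single s 1) (m + s) = Poly_Mapping.lookup p m"
proof -
  let ?q = "\<lambda>k. Poly_Mapping.single k (Poly_Mapping.lookup p k)"
  have "p * Poly_Mapping.single s 1
      = (\<Sum>k\<in>Poly_Mapping.keys p. Poly_Mapping.single (k + s) (Poly_Mapping.lookup p k))"
    by (subst (1) poly_mapping_eq_sum_single[of p]) (simp add: sum_distrib_right mult_single)
  then show ?thesis
    by (auto simp: lookup_sum lookup_single when_def in_keys_iff)
qed

lemma keys_times_single:
  fixes p :: mpoly
  assumes "k \<in> Poly_Mapping.keys (p * Poly_Mapping.single s 1)"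
  obtains m where "m \<in> Poly_Mapping.keys p" "k = m + s"
  using assms keys_mult[of p "Poly_Mapping.single s (1::complex)"] by auto

lemma const_1 [simp]: "const 1 = 1"
  by (simp add: const_def)

lemma const_mult: "const (x * y) = const x * const y"
  by (simp add: const_def mult_single flip: to_fract_mult)

lemma const_eq_0_iff [simp]: "const x = 0 \<longleftrightarrow> x = 0"
  using keys_eq_empty by (auto simp: const_def) (metis lookup_single_eq lookup_zero)

locale coefficient_field =
  fixes F :: "complex set"
  assumes subring_F: "unital_subring F"
    and inverse_F: "x \<in> F \<Longrightarrow> inverse x \<in> F"
begin

sublocale F: unital_subring F by (rule subring_F)

lemma single_in_mpolys:
  "c \<in> F \<Longrightarrow> Poly_Mapping.keys m \<subseteq> {1..n} \<Longrightarrow> Poly_Mapping.single m c \<in> mpolys F n"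
  by (auto simp: mpolys_def lookup_single when_def)

lemma diff_in_mpolys: "p \<in> mpolys F n \<Longrightarrow> q \<in> mpolys F n \<Longrightarrow> p - q \<in> mpolys F n"
  unfolding mpolys_def using keys_diff[of p q] by (simp add: lookup_minus F.diff_closed) blast

lemma sum_in_mpolys: "(\<And>i. i \<in> I \<Longrightarrow> g i \<in> mpolys F n) \<Longrightarrow> sum g I \<in> mpolys F n"
proof (induction I rule: infinite_finite_induct)
  case (insert i I)
  have "0 \<in> mpolys F n" by (simp add: mpolys_def)
  then have "g i - (0 - sum g I) \<in> mpolys F n"
    using insert by (intro diff_in_mpolys) auto
  then show ?case using insert by simp
qed (simp_all add: mpolys_def)

lemma mult_in_mpolys:
  assumes "p \<in> mpolys F n" "q \<in> mpolys F n"
  shows "p * q \<in> mpolys F n"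
proof -
  have "p * q = (\<Sum>m\<in>Poly_Mapping.keys p. \<Sum>k\<in>Poly_Mapping.keys q.
      Poly_Mapping.single (m + k) (Poly_Mapping.lookup p m * Poly_Mapping.lookup q k))"
    by (subst poly_mapping_eq_sum_single[of p], subst poly_mapping_eq_sum_single[of q])
      (simp add: sum_product mult_single)
  also have "\<dots> \<in> mpolys F n"
  proof (intro sum_in_mpolys single_in_mpolys)
    fix m k assume "m \<in> Poly_Mapping.keys p" "k \<in> Poly_Mapping.keys q"
    then show "Poly_Mapping.keys (m + k) \<subseteq> {1..n}"
      using assms keys_add[of m k] unfolding mpolys_def by blast
    show "Poly_Mapping.lookup p m * Poly_Mapping.lookup q k \<in> F"
      using assms unfolding mpolys_def by blast
  qed
  finally show ?thesis .
qed

lemma polys_eq: "polys F n = to_fract ` mpolys F n"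
  unfolding polys_def mpolys_def using F.zero_closed
  by (intro arg_cong[of _ _ "image to_fract"] Collect_cong)
    (metis not_in_keys_iff_lookup_eq_zero)

lemma const_in_polys: "z \<in> F \<Longrightarrow> const z \<in> polys F n"
  unfolding polys_eq const_def by (intro imageI single_in_mpolys) auto

lemma alpha_in_polys: "1 \<le> i \<Longrightarrow> i \<le> n \<Longrightarrow> alpha i \<in> polys F n"
  unfolding polys_eq alpha_def by (intro imageI single_in_mpolys) auto

lemma unital_subring_polys: "unital_subring (polys F n)"
proof
  show "1 \<in> polys F n" using const_in_polys[of 1] by simp
next
  fix x y assume "x \<in> polys F n" "y \<in> polys F n"
  then show "x - y \<in> polys F n" "x * y \<in> polys F n"
    unfolding polys_eq using diff_in_mpolys mult_in_mpolys
    by (auto simp flip: to_fract_diff to_fract_mult)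
qed

lemma polys_mono: "m \<le> n \<Longrightarrow> polys F m \<subseteq> polys F n"
  unfolding polys_eq mpolys_def by (intro image_mono) fastforce

lemma polys_0: "polys F 0 = const ` F"
proof
  show "const ` F \<subseteq> polys F 0" using const_in_polys by blast
  show "polys F 0 \<subseteq> const ` F"
  proof
    fix x assume "x \<in> polys F 0"
    then obtain p where p: "p \<in> mpolys F 0" "x = to_fract p" by (auto simp: polys_eq)
    then have "m = 0" if "m \<in> Poly_Mapping.keys p" for m
      using that by (auto simp: mpolys_def)
    then have "p = Poly_Mapping.single 0 (Poly_Mapping.lookup p 0)"
      by (intro poly_mapping_eqI) (metis lookup_single when_def not_in_keys_iff_lookup_eq_zero)
    then show "x \<in> const ` F" using p by (auto simp: const_def mpolys_def)
  qed
qed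

text \<open>
  The inclusion from left to right is checked on monomials, by splitting off the power of the last variable.
\<close>

lemma polys_Suc: "polys F (Suc n) = (\<lambda>A. poly A (alpha (Suc n))) ` polys_over (polys F n)"
    (is "_ = ?I")
proof
  interpret R: unital_subring "polys F n" by (rule unital_subring_polys)
  interpret R': unital_subring "polys F (Suc n)" by (rule unital_subring_polys)
  show "?I \<subseteq> polys F (Suc n)"
  proof safe
    fix A assume "A \<in> polys_over (polys F n)"
    then have "Polynomial.coeff A i \<in> polys F (Suc n)" for i
      using polys_mono[of n "Suc n"] by (auto simp: polys_over_def)
    then show "poly A (alpha (Suc n)) \<in> polys F (Suc n)"
      unfolding poly_altdef using alpha_in_polys[of "Suc n" "Suc n"]
      by (intro R'.sum_closed R'.mult_closed R'.power_closed) auto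
  qed
  have I_sum: "sum g S \<in> ?I" if "\<And>s. s \<in> S \<Longrightarrow> g s \<in> ?I" for g and S :: "(nat \<Rightarrow>\<^sub>0 nat) set"
  proof -
    have "\<forall>s\<in>S. \<exists>A. A \<in> polys_over (polys F n) \<and> g s = poly A (alpha (Suc n))"
      using that by blast
    then obtain A where "\<And>s. s \<in> S \<Longrightarrow> A s \<in> polys_over (polys F n)"
      "\<And>s. s \<in> S \<Longrightarrow> g s = poly (A s) (alpha (Suc n))" by metis
    then show ?thesis
      using unital_subring.sum_closed[OF R.unital_subring_polys_over, of S A]
      by (auto simp: image_iff poly_sum intro!: bexI[of _ "sum A S"])
  qed
  show "polys F (Suc n) \<subseteq> ?I"
  proof
    fix x assume "x \<in> polys F (Suc n)"
    then obtain p where p: "p \<in> mpolys F (Suc n)" "x = to_fract p" by (auto simp: polys_eq)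
    have "to_fract (Poly_Mapping.single m (Poly_Mapping.lookup p m)) \<in> ?I"
      if m: "m \<in> Poly_Mapping.keys p" for m
    proof -
      define m' where "m' = Poly_Mapping.update (Suc n) 0 m"
      define e where "e = Poly_Mapping.lookup m (Suc n)"
      define c where "c = Poly_Mapping.lookup p m"
      have "Poly_Mapping.keys m \<subseteq> {1..Suc n}" using p m by (auto simp: mpolys_def)
      then have "Poly_Mapping.keys m' \<subseteq> {1..n}"
        unfolding m'_def by (fastforce simp: keys_update)
      then have inR: "to_fract (Poly_Mapping.single m' c) \<in> polys F n"
        using p single_in_mpolys unfolding polys_eq c_def by (auto simp: mpolys_def)
      have "m = m' + Poly_Mapping.single (Suc n) e"
        by (rule poly_mapping_eqI)
          (auto simp: m'_def e_def lookup_add lookup_update lookup_single when_def)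
      then have "Poly_Mapping.single m c
          = Poly_Mapping.single m' c * Poly_Mapping.single (Poly_Mapping.single (Suc n) 1) 1 ^ e"
        by (simp add: single_var_power mult_single del: One_nat_def)
      then have "to_fract (Poly_Mapping.single m c)
          = poly (Polynomial.monom (to_fract (Poly_Mapping.single m' c)) e) (alpha (Suc n))"
        by (simp add: poly_monom alpha_def to_fract_pow)
      then show ?thesis using R.monom_in_polys_over[OF inR] unfolding c_def by blast
    qed
    then show "x \<in> ?I"
      using I_sum unfolding p(2) by (subst poly_mapping_eq_sum_single) (simp only: to_fract_sum)
  qed
qed

text \<open>
  The summands have pairwise disjoint supports, because the exponent of the new variable in the \<open>i\<close>-th
  summand is always \<open>i\<close>; so no cancellation can occur.
\<close>

lemma mpolys_transcendental:
  fixes a :: "nat \<Rightarrow> mpoly"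
  assumes a: "\<And>i. i \<le> N \<Longrightarrow> a i \<in> mpolys F n"
    and zero: "(\<Sum>i\<le>N. a i * Poly_Mapping.single (Poly_Mapping.single (Suc n) 1) 1 ^ i) = 0"
    and "j \<le> N"
  shows "a j = 0"
proof (rule poly_mapping_eqI)
  fix m
  let ?s = "\<lambda>i. Poly_Mapping.single (Suc n) i"
  show "Poly_Mapping.lookup (a j) m = Poly_Mapping.lookup 0 m"
  proof (cases "m \<in> Poly_Mapping.keys (a j)")
    case False
    then show ?thesis by (simp add: in_keys_iff)
  next
    case True
    have no: "Poly_Mapping.lookup k (Suc n) = 0" if "k \<in> Poly_Mapping.keys (a i)" "i \<le> N" for i k
      using that a[of i] by (fastforce simp: mpolys_def in_keys_iff)
    have other: "Poly_Mapping.lookup (a i * Poly_Mapping.single (?s i) 1) (m + ?s j) = 0"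
      if "i \<le> N" "i \<noteq> j" for i
    proof (rule ccontr)
      assume "\<not> ?thesis"
      then have "m + ?s j \<in> Poly_Mapping.keys (a i * Poly_Mapping.single (?s i) 1)"
        by (simp add: in_keys_iff)
      then obtain k where k: "k \<in> Poly_Mapping.keys (a i)" "m + ?s j = k + ?s i"
        by (rule keys_times_single)
      then have "Poly_Mapping.lookup (m + ?s j) (Suc n) = Poly_Mapping.lookup (k + ?s i) (Suc n)"
        by simp
      then show False using no[OF k(1)] no[OF True] that assms(3) by (simp add: lookup_add)
    qed
    have "0 = (\<Sum>i\<le>N. Poly_Mapping.lookup (a i * Poly_Mapping.single (?s i) 1) (m + ?s j))"
      using zero by (simp add: single_var_power del: One_nat_def flip: lookup_sum)
    also have "\<dots> = (\<Sum>i\<in>{j}. Poly_Mapping.lookup (a i * Poly_Mapping.single (?s i) 1) (m + ?s j))"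
      using other assms(3) by (intro sum.mono_neutral_right) auto
    also have "\<dots> = Poly_Mapping.lookup (a j) m" by (simp add: lookup_times_single_shift)
    finally show ?thesis by simp
  qed
qed

lemma alpha_transcendental:
  assumes A: "A \<in> polys_over (polys F n)" and "poly A (alpha (Suc n)) = 0"
  shows "A = 0"
proof -
  have "\<forall>i. \<exists>b. b \<in> mpolys F n \<and> Polynomial.coeff A i = to_fract b"
    using A by (auto simp: polys_over_def polys_eq)
  then obtain b where b: "\<And>i. b i \<in> mpolys F n" "\<And>i. Polynomial.coeff A i = to_fract (b i)"
    by metis
  let ?x = "Poly_Mapping.single (Poly_Mapping.single (Suc n) 1) 1 :: mpoly"
  have "to_fract (\<Sum>i\<le>Polynomial.degree A. b i * ?x ^ i) = 0"
    using assms(2) by (simp add: poly_altdef b(2) alpha_def to_fract_pow)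
  then have "b (Polynomial.degree A) = 0"
    using mpolys_transcendental[of "Polynomial.degree A" b n "Polynomial.degree A"] b(1)
    by (simp only: to_fract_eq_0_iff)
  then show ?thesis using b(2)[of "Polynomial.degree A"] by simp
qed

lemma ring_embedding_eval:
  "ring_embedding (polys_over (polys F n)) (\<lambda>A. poly A (alpha (Suc n)))"
proof -
  interpret R: unital_subring "polys F n" by (rule unital_subring_polys)
  interpret P: unital_subring "polys_over (polys F n)" by (rule R.unital_subring_polys_over)
  show ?thesis
  proof
    show "inj_on (\<lambda>A. poly A (alpha (Suc n))) (polys_over (polys F n))"
    proof (rule inj_onI)
      fix A B assume AB: "A \<in> polys_over (polys F n)" "B \<in> polys_over (polys F n)"
        "poly A (alpha (Suc n)) = poly B (alpha (Suc n))"
      then have "A - B = 0"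
        by (intro alpha_transcendental[of _ n]) (auto intro: P.diff_closed)
      then show "A = B" by simp
    qed
  qed auto
qed

lemma factorial_subring_constants: "factorial_subring (const ` F)"
proof -
  interpret R: unital_subring "const ` F" using unital_subring_polys[of 0] polys_0 by simp
  have unit: "unit_in (const ` F) x" if "x \<in> const ` F" "x \<noteq> 0" for x
  proof -
    from that obtain z where z: "z \<in> F" "z \<noteq> 0" "x = const z" by auto
    then have "const z * const (inverse z) = 1" by (simp flip: const_mult)
    then show ?thesis using z inverse_F unfolding unit_in_def dvd_in_def by (metis image_eqI)
  qed
  show ?thesis
  proof
    show "\<exists>\<mu> :: ratfun \<Rightarrow> nat. (\<forall>x\<in>const ` F - {0}. \<forall>y\<in>const ` F - {0}. \<mu> (x * y) = \<mu> x + \<mu> y)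
        \<and> (\<forall>x\<in>const ` F - {0}. \<mu> x = 0 \<longrightarrow> unit_in (const ` F) x)"
      by (rule exI[of _ "\<lambda>_. 0"]) (use unit in auto)
    show "prime_in (const ` F) p" if "irreducible_in (const ` F) p" for p
      using that unit by (auto simp: irreducible_in_def)
  qed
qed

theorem factorial_subring_polys: "factorial_subring (polys F n)"
proof (induction n)
  case 0
  then show ?case using factorial_subring_constants by (simp add: polys_0)
next
  case (Suc n)
  then show ?case
    unfolding polys_Suc
    by (intro factorial_subring_image ring_embedding_eval
        factorial_subring.factorial_subring_polys_over)
qed

lemma unit_in_polys: "unit_in (polys F n) u \<Longrightarrow> \<exists>z\<in>F - {0}. u = const z"
proof (induction n arbitrary: u)
  case 0
  then obtain z w where z: "z \<in> F" "u = const z" "1 = const z * const w"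
    by (auto simp: unit_in_def dvd_in_def polys_0)
  then have "z \<noteq> 0" by (metis const_eq_0_iff mult_zero_left zero_neq_one)
  then show ?case using z by blast
next
  case (Suc n)
  interpret R: unital_subring "polys F n" by (rule unital_subring_polys)
  interpret E: ring_embedding "polys_over (polys F n)" "\<lambda>A. poly A (alpha (Suc n))"
    by (rule ring_embedding_eval)
  obtain U where "U \<in> polys_over (polys F n)" "u = poly U (alpha (Suc n))"
    using Suc.prems by (auto simp: unit_in_def polys_Suc)
  moreover from this have "unit_in (polys_over (polys F n)) U"
    using Suc.prems E.unit_in_image by (simp add: polys_Suc)
  ultimately obtain v where "u = v" "unit_in (polys F n) v"
    by (auto simp: R.unit_in_polys_over_iff)
  then show ?case using Suc.IH by blast
qed

end

section \<open>Denominators along an orbit of primes\<close>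

text \<open>
  The step from \<open>-1\<close> to \<open>0\<close> is the only one that may fail, so an element at or above \<open>0\<close> propagates upwards for ever, and
  an element below \<open>0\<close> downwards.
\<close>

lemma step_invariant_finite_int_set_empty:
  fixes E :: "int set"
  assumes fin: "finite E" and step: "\<And>k. k \<noteq> 0 \<Longrightarrow> k \<in> E \<longleftrightarrow> k - 1 \<in> E"
  shows "E = {}"
proof (rule ccontr)
  assume "E \<noteq> {}"
  then have E: "Max E \<in> E" "Min E \<in> E" "Min E \<le> Max E" using fin by auto
  show False
  proof (cases "Max E \<ge> 0")
    case True
    then have "Max E + 1 \<in> E" using step[of "Max E + 1"] E by simp
    then show False using Max_ge[OF fin] by force
  next
    case False
    then have "Min E - 1 \<in> E" using step[of "Min E"] E by auto
    then show False using Min_le[OF fin] by force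
  qed
qed

context factorial_subring
begin

lemma prime_not_dvd_unit: "prime_in R p \<Longrightarrow> unit_in R u \<Longrightarrow> \<not> dvd_in R p u"
  using dvd_in_trans by (auto simp: prime_in_def unit_in_def)

lemma prime_dvd_mult_iff:
  "prime_in R p \<Longrightarrow> x \<in> R \<Longrightarrow> y \<in> R \<Longrightarrow> dvd_in R p (x * y) \<longleftrightarrow> dvd_in R p x \<or> dvd_in R p y"
  using dvd_in_mult_left dvd_in_mult_right by (auto simp: prime_in_def)

text \<open>
  Dividing \<open>Q\<close> by one of its prime divisors \<open>d k\<close> keeps all the others.
\<close>

lemma finite_prime_divisor_indices:
  assumes prime: "\<And>k. prime_in R (d k)" and ndvd: "\<And>k l. dvd_in R (d k) (d l) \<Longrightarrow> k = l"
    and "Q \<in> R" "Q \<noteq> 0"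
  shows "finite {k. dvd_in R (d k) Q}"
  using assms(3,4)
proof (induction "size_in Q" arbitrary: Q rule: less_induct)
  case less
  show ?case
  proof (cases "\<exists>k. dvd_in R (d k) Q")
    case False
    then show ?thesis by simp
  next
    case True
    then obtain k Q' where Q': "Q' \<in> R" "Q = d k * Q'" by (auto simp: dvd_in_def)
    have dk: "d k \<in> R" "\<not> unit_in R (d k)" using prime[of k] by (auto simp: prime_in_def)
    have "{l. dvd_in R (d l) Q} \<subseteq> insert k {l. dvd_in R (d l) Q'}"
      using prime_dvd_mult_iff[OF prime dk(1) Q'(1)] ndvd unfolding Q'(2) by blast
    moreover have "size_in Q' < size_in Q" "Q' \<noteq> 0"
      using size_in_less[OF dk(1) Q'(1) _ dk(2)] less.prems Q'(2) by auto
    then have "finite {l. dvd_in R (d l) Q'}" using less.hyps Q'(1) by blast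
    ultimately show ?thesis using finite_subset by blast
  qed
qed

end

text \<open>
  The setting of the denominator argument, freed from polynomials: an automorphism of a factorial
  ring and a doubly infinite orbit of pairwise nonassociated primes.
\<close>

locale prime_orbit = factorial_subring R + ring_embedding R \<sigma>
    for R :: "'a::idom set" and \<sigma> :: "'a \<Rightarrow> 'a" +
  fixes d :: "int \<Rightarrow> 'a" and c :: 'a
  assumes surj: "\<sigma> ` R = R"
    and prime: "\<And>k. prime_in R (d k)"
    and nonassociated: "\<And>k l. dvd_in R (d k) (d l) \<Longrightarrow> k = l"
    and shift: "\<And>k. \<sigma> (d k) = d (k + 1)"
    and unit_c: "unit_in R c"
begin

lemma orbit_closed: "d k \<in> R"
  using prime by (simp add: prime_in_def)

lemma \<sigma>_closed: "x \<in> R \<Longrightarrow> \<sigma> x \<in> R"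
  using surj by blast

lemma dvd_in_\<sigma>: "a \<in> R \<Longrightarrow> b \<in> R \<Longrightarrow> dvd_in R (\<sigma> a) (\<sigma> b) \<longleftrightarrow> dvd_in R a b"
  using dvd_in_image by (simp add: surj)

lemma orbit_dvd_\<sigma>: "x \<in> R \<Longrightarrow> dvd_in R (d k) (\<sigma> x) \<longleftrightarrow> dvd_in R (d (k - 1)) x"
  using dvd_in_\<sigma>[OF orbit_closed, of x "k - 1"] shift[of "k - 1"] by simp

text \<open>
  For \<open>k \<noteq> 0\<close>, coprimality and the equation make \<open>d k\<close> divide \<open>Q\<close> exactly when it divides \<open>\<sigma> Q\<close>, that is,
  when \<open>d (k - 1)\<close> divides \<open>Q\<close>. Finiteness then excludes every \<open>d k\<close> from \<open>Q\<close>, and \<open>d 0\<close> divides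
  only the right-hand side of the equation.
\<close>

lemma no_coprime_solution:
  assumes in_R: "P \<in> R" "Q \<in> R" "b \<in> R" "h \<in> R" and Q0: "Q \<noteq> 0"
    and coprime: "\<And>p. prime_in R p \<Longrightarrow> dvd_in R p P \<Longrightarrow> dvd_in R p Q \<Longrightarrow> False"
    and b: "\<not> dvd_in R (d 0) b" and h: "\<And>k. \<not> dvd_in R (d k) h" and j: "j \<noteq> 0"
    and eq: "b * Q * \<sigma> Q = h * d 0 ^ j * (c * \<sigma> P * Q - P * \<sigma> Q)"
  shows False
proof -
  let ?E = "{k. dvd_in R (d k) Q}"
  let ?N = "c * \<sigma> P * Q - P * \<sigma> Q"
  have cR: "c \<in> R" using unit_c by (simp add: unit_in_def)
  note \<sigma>_in_R = \<sigma>_closed[OF in_R(1)] \<sigma>_closed[OF in_R(2)]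
  have NR: "?N \<in> R"
    by (intro diff_closed mult_closed in_R cR \<sigma>_in_R)
  have hdR: "h * d 0 ^ j \<in> R" by (intro mult_closed power_closed in_R orbit_closed)
  have c\<sigma>PR: "c * \<sigma> P \<in> R" and bQR: "b * Q \<in> R"
    by (intro mult_closed in_R cR \<sigma>_in_R)+
  have dvd_c\<sigma>P: "dvd_in R (d k) (c * \<sigma> P) \<longleftrightarrow> dvd_in R (d k) (\<sigma> P)" for k
    using prime_dvd_mult_iff[OF prime cR \<sigma>_in_R(1)] prime_not_dvd_unit[OF prime unit_c] by blast
  note dvd_c\<sigma>PQ = prime_dvd_mult_iff[OF prime c\<sigma>PR in_R(2), unfolded dvd_c\<sigma>P]
  note dvd_P\<sigma>Q = prime_dvd_mult_iff[OF prime in_R(1) \<sigma>_in_R(2)]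
  have dvd_lhs: "dvd_in R (d k) (b * Q * \<sigma> Q) \<longleftrightarrow>
      dvd_in R (d k) b \<or> dvd_in R (d k) Q \<or> dvd_in R (d k) (\<sigma> Q)" for k
    using prime_dvd_mult_iff[OF prime bQR \<sigma>_in_R(2)] prime_dvd_mult_iff[OF prime in_R(3,2)]
    by blast
  have not_dvd_hd: "\<not> dvd_in R (d k) (h * d 0 ^ j)" if "k \<noteq> 0" for k
    using prime_dvd_mult_iff[OF prime in_R(4) power_closed[OF orbit_closed]] h[of k]
      prime_in_power[OF prime orbit_closed] nonassociated that by blast
  have dvd_N: "dvd_in R (d k) ?N" if "k \<noteq> 0" "dvd_in R (d k) Q \<or> dvd_in R (d k) (\<sigma> Q)" for k
  proof -
    have "dvd_in R (d k) (b * Q * \<sigma> Q)" using that(2) dvd_lhs by blast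
    then have "dvd_in R (d k) (h * d 0 ^ j * ?N)" unfolding eq .
    then show ?thesis
      using not_dvd_hd[OF that(1)] prime_dvd_mult_iff[OF prime hdR NR] by blast
  qed
  have "k \<in> ?E \<longleftrightarrow> k - 1 \<in> ?E" if "k \<noteq> 0" for k
  proof
    assume "k \<in> ?E"
    then have k: "dvd_in R (d k) Q" by simp
    then have "dvd_in R (d k) (c * \<sigma> P * Q)" using dvd_c\<sigma>PQ by blast
    moreover have "dvd_in R (d k) ?N" using dvd_N that k by blast
    ultimately have "dvd_in R (d k) (P * \<sigma> Q)"
      using dvd_in_diff[of "d k" "c * \<sigma> P * Q" ?N] by simp
    then have "dvd_in R (d k) (\<sigma> Q)" using coprime[OF prime] k dvd_P\<sigma>Q by blast
    then show "k - 1 \<in> ?E" using orbit_dvd_\<sigma> in_R by blast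
  next
    assume "k - 1 \<in> ?E"
    then have k: "dvd_in R (d (k - 1)) Q" by simp
    then have dQ: "dvd_in R (d k) (\<sigma> Q)" using orbit_dvd_\<sigma>[OF in_R(2)] by simp
    have "\<not> dvd_in R (d k) (\<sigma> P)"
      using coprime[OF prime _ k] orbit_dvd_\<sigma>[OF in_R(1)] by blast
    moreover have "dvd_in R (d k) ?N" using dvd_N that dQ by blast
    then have "dvd_in R (d k) (?N + P * \<sigma> Q)"
      using dvd_in_add dvd_P\<sigma>Q dQ by blast
    then have "dvd_in R (d k) (c * \<sigma> P * Q)" by simp
    ultimately show "k \<in> ?E" using dvd_c\<sigma>PQ by blast
  qed
  then have "?E = {}"
    using finite_prime_divisor_indices[OF prime nonassociated in_R(2) Q0]
    by (intro step_invariant_finite_int_set_empty)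
  then have "\<not> dvd_in R (d 0) Q" "\<not> dvd_in R (d 0) (\<sigma> Q)"
    using orbit_dvd_\<sigma> in_R(2) by blast+
  then have "\<not> dvd_in R (d 0) (b * Q * \<sigma> Q)"
    using b dvd_lhs by blast
  moreover have "dvd_in R (d 0) (d 0 ^ j)"
    using j orbit_closed power_closed by (cases j) (auto simp: dvd_in_def)
  then have "dvd_in R (d 0) (h * d 0 ^ j * ?N)"
    using in_R(4) NR dvd_in_mult_left dvd_in_mult_right by blast
  ultimately show False using eq by simp
qed

text \<open>
  A common prime factor \<open>p\<close> of \<open>P\<close> and \<open>Q\<close> cancels from the equation as \<open>p * \<sigma> p\<close>.
\<close>

lemma no_solution:
  assumes "P \<in> R" "Q \<in> R" "b \<in> R" "h \<in> R" "Q \<noteq> 0"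
    and b: "\<not> dvd_in R (d 0) b" and h: "\<And>k. \<not> dvd_in R (d k) h" and j: "j \<noteq> 0"
    and "b * Q * \<sigma> Q = h * d 0 ^ j * (c * \<sigma> P * Q - P * \<sigma> Q)"
  shows False
  using assms(1,2,5,9)
proof (induction "size_in Q" arbitrary: P Q rule: less_induct)
  case less
  show ?case
  proof (cases "\<exists>p. prime_in R p \<and> dvd_in R p P \<and> dvd_in R p Q")
    case False
    then show ?thesis
      using no_coprime_solution[OF less.prems(1,2) assms(3,4) less.prems(3) _ b h j less.prems(4)]
      by blast
  next
    case True
    then obtain p P' Q' where p: "prime_in R p" and PQ: "P' \<in> R" "Q' \<in> R" "P = p * P'" "Q = p * Q'"
      unfolding dvd_in_def by blast
    have pR: "p \<in> R" "p \<noteq> 0" "\<not> unit_in R p" using p by (auto simp: prime_in_def)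
    have "p * \<sigma> p * (b * Q' * \<sigma> Q') = p * \<sigma> p * (h * d 0 ^ j * (c * \<sigma> P' * Q' - P' * \<sigma> Q'))"
      using less.prems(4) PQ pR(1) by (simp add: hom_mult algebra_simps)
    moreover have "p * \<sigma> p \<noteq> 0" using pR hom_eq_0_iff by simp
    ultimately have "b * Q' * \<sigma> Q' = h * d 0 ^ j * (c * \<sigma> P' * Q' - P' * \<sigma> Q')" by simp
    moreover have "size_in Q' < size_in Q" "Q' \<noteq> 0"
      using size_in_less[OF pR(1) PQ(2) _ pR(3)] less.prems PQ(4) by auto
    ultimately show ?thesis using less.hyps PQ by blast
  qed
qed

end

section \<open>Powers of an automorphism\<close>

lemma auto_power_0 [simp]: "auto_power K \<sigma> 0 x = x"
  by (simp add: auto_power_def)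

text \<open>
  Negative powers are defined through an inverse relative to \<open>K\<close>, so all laws of powers hold
  only on \<open>K\<close>. They are obtained by integer induction, where the step downwards applies \<open>\<sigma>\<close> to both
  sides and uses injectivity.
\<close>

locale set_bijection =
  fixes K :: "ratfun set" and \<sigma> :: "ratfun \<Rightarrow> ratfun"
  assumes bij: "bij_betw \<sigma> K K"
begin

abbreviation pow :: "int \<Rightarrow> ratfun \<Rightarrow> ratfun" where "pow \<equiv> auto_power K \<sigma>"

lemma \<sigma>_in_K: "x \<in> K \<Longrightarrow> \<sigma> x \<in> K"
  using bij by (rule bij_betwE[THEN bspec])

lemma \<sigma>_eq_iff: "x \<in> K \<Longrightarrow> y \<in> K \<Longrightarrow> \<sigma> x = \<sigma> y \<longleftrightarrow> x = y"
  using bij by (meson bij_betw_def inj_on_eq_iff)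

lemma pow_in_K: "x \<in> K \<Longrightarrow> pow k x \<in> K"
proof -
  assume x: "x \<in> K"
  have "(\<sigma> ^^ m) x \<in> K" for m by (induction m) (auto simp: x \<sigma>_in_K)
  moreover have "(inv_into K \<sigma> ^^ m) x \<in> K" for m
    using bij by (induction m) (auto simp: x bij_betw_def intro: inv_into_into)
  ultimately show ?thesis by (simp add: auto_power_def)
qed

lemma pow_Suc: "x \<in> K \<Longrightarrow> pow (k + 1) x = \<sigma> (pow k x)"
proof (cases "k \<ge> 0")
  case True
  then show ?thesis by (simp add: auto_power_def nat_add_distrib)
next
  case False
  assume x: "x \<in> K"
  define m where "m = nat (- k - 1)"
  have m: "nat (- k) = Suc m" "nat (- (k + 1)) = m" using False by (auto simp: m_def)
  have "pow k x = inv_into K \<sigma> ((inv_into K \<sigma> ^^ m) x)"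
    using False m by (simp add: auto_power_def)
  moreover have "pow (k + 1) x = (inv_into K \<sigma> ^^ m) x"
    using False m by (cases "k + 1 = 0") (auto simp: auto_power_def m_def)
  moreover from this have "(inv_into K \<sigma> ^^ m) x \<in> K" using pow_in_K[OF x, of "k + 1"] by simp
  ultimately show ?thesis using bij by (simp add: bij_betw_def f_inv_into_f)
qed

lemma pow_pred: "x \<in> K \<Longrightarrow> \<sigma> (pow (k - 1) x) = pow k x"
  using pow_Suc[of x "k - 1"] by simp

lemma pow_add: "x \<in> K \<Longrightarrow> pow (k + l) x = pow k (pow l x)"
proof (induction k rule: int_induct[where k = 0])
  case (step1 i)
  then show ?case using pow_Suc[of x "i + l"] pow_Suc[OF pow_in_K, of x i l]
    by (simp add: algebra_simps)
next
  case (step2 i)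
  have "\<sigma> (pow (i - 1 + l) x) = pow (i + l) x"
    using pow_pred[OF step2.prems, of "i + l"] by (simp add: algebra_simps)
  also have "\<dots> = \<sigma> (pow (i - 1) (pow l x))"
    using step2 pow_pred[OF pow_in_K, of x i l] by simp
  finally show ?case using step2.prems by (simp add: \<sigma>_eq_iff pow_in_K)
qed simp

lemma pow_inj: "inj_on (pow k) K"
proof (rule inj_onI)
  fix x y assume "x \<in> K" "y \<in> K" "pow k x = pow k y"
  then show "x = y" using pow_add[of x "- k" k] pow_add[of y "- k" k] by simp
qed

lemma pow_fixed: "x \<in> K \<Longrightarrow> \<sigma> x = x \<Longrightarrow> pow k x = x"
proof (induction k rule: int_induct[where k = 0])
  case (step1 i)
  then show ?case by (simp add: pow_Suc)
next
  case (step2 i)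
  then have "\<sigma> (pow (i - 1) x) = \<sigma> x" by (simp add: pow_pred)
  then show ?case using step2.prems(1) \<sigma>_eq_iff pow_in_K by blast
qed simp

lemma pow_image_invariant:
  assumes A: "A \<subseteq> K" "\<sigma> ` A = A"
  shows "pow k ` A = A"
proof (induction k rule: int_induct[where k = 0])
  case (step1 i)
  have "pow (i + 1) ` A = \<sigma> ` pow i ` A"
    unfolding image_image using pow_Suc A(1) by (intro image_cong) auto
  then show ?case using step1 A by simp
next
  case (step2 i)
  have "\<sigma> ` pow (i - 1) ` A = pow i ` A"
    unfolding image_image using pow_pred A(1) by (intro image_cong) auto
  then have eq: "\<sigma> ` pow (i - 1) ` A = \<sigma> ` A" using step2(2) A(2) by (simp only:)
  moreover have "pow (i - 1) ` A \<subseteq> K" using pow_in_K A by auto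
  ultimately show ?case
    using inj_on_image_eq_iff[OF bij_betw_imp_inj_on[OF bij] _ A(1)] by (simp only:)
qed simp

text \<open>
  Used for subtraction and for multiplication.
\<close>

lemma pow_binary_hom:
  assumes closed: "\<And>x y. x \<in> K \<Longrightarrow> y \<in> K \<Longrightarrow> f x y \<in> K"
    and hom: "\<And>x y. x \<in> K \<Longrightarrow> y \<in> K \<Longrightarrow> \<sigma> (f x y) = f (\<sigma> x) (\<sigma> y)"
    and "x \<in> K" "y \<in> K"
  shows "pow k (f x y) = f (pow k x) (pow k y)"
proof (induction k rule: int_induct[where k = 0])
  case (step1 i)
  then show ?case using assms by (simp add: pow_Suc pow_in_K)
next
  case (step2 i)
  have "\<sigma> (pow (i - 1) (f x y)) = \<sigma> (f (pow (i - 1) x) (pow (i - 1) y))"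
    using step2 assms by (simp add: pow_pred pow_in_K)
  then show ?case
    by (rule \<sigma>_eq_iff[THEN iffD1, rotated 2]) (intro closed pow_in_K assms(3,4))+
qed simp

end

section \<open>Rational functions and the degree in the last variable\<close>

context coefficient_field
begin

lemma polys_subset_ratfuns: "polys F n \<subseteq> ratfuns F n"
proof
  interpret R: unital_subring "polys F n" by (rule unital_subring_polys)
  fix p assume "p \<in> polys F n"
  then show "p \<in> ratfuns F n"
    unfolding ratfuns_def by (intro CollectI exI[of _ p] exI[of _ 1]) simp
qed

lemma unital_subring_ratfuns: "unital_subring (ratfuns F n)"
proof
  interpret R: unital_subring "polys F n" by (rule unital_subring_polys)
  show "1 \<in> ratfuns F n" using polys_subset_ratfuns by blast
  fix x y assume "x \<in> ratfuns F n" "y \<in> ratfuns F n"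
  then obtain p q p' q' where *: "p \<in> polys F n" "q \<in> polys F n" "q \<noteq> 0" "x = p / q"
    "p' \<in> polys F n" "q' \<in> polys F n" "q' \<noteq> 0" "y = p' / q'"
    by (auto simp: ratfuns_def)
  have "x - y = (p * q' - p' * q) / (q * q')" "x * y = (p * p') / (q * q')"
    unfolding *(4,8) using *(3,7) by (simp_all add: diff_frac_eq)
  moreover have "p * q' - p' * q \<in> polys F n" "p * p' \<in> polys F n" "q * q' \<in> polys F n"
    using * by blast+
  moreover have "q * q' \<noteq> 0" using * by simp
  ultimately show "x - y \<in> ratfuns F n" "x * y \<in> ratfuns F n"
    unfolding ratfuns_def by blast+
qed

lemma common_denominator:
  assumes "A \<in> polys_over (ratfuns F m)"
  shows "\<exists>h\<in>polys F m - {0}. Polynomial.smult h A \<in> polys_over (polys F m)"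
proof -
  interpret R: unital_subring "polys F m" by (rule unital_subring_polys)
  interpret Q: unital_subring "ratfuns F m" by (rule unital_subring_ratfuns)
  show ?thesis using assms
  proof (induction A)
    case 0
    then show ?case by (intro bexI[of _ 1]) (auto simp: polys_over_def)
  next
    case (pCons a A)
    then obtain h where h: "h \<in> polys F m" "h \<noteq> 0"
      "Polynomial.smult h A \<in> polys_over (polys F m)"
      by (auto simp: Q.pCons_in_polys_over)
    obtain p q where pq: "p \<in> polys F m" "q \<in> polys F m" "q \<noteq> 0" "a = p / q"
      using pCons.prems unfolding Q.pCons_in_polys_over by (auto simp: ratfuns_def)
    have "Polynomial.smult (q * h) (pCons a A)
        = pCons (h * p) (Polynomial.smult q (Polynomial.smult h A))"
      using pq by simp
    also have "\<dots> \<in> polys_over (polys F m)"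
      using h pq R.smult_in_polys_over unfolding R.pCons_in_polys_over by blast
    finally show ?case
      using h pq by (intro bexI[of _ "q * h"]) auto
  qed
qed

lemma alpha_transcendental_over_ratfuns:
  assumes "A \<in> polys_over (ratfuns F m)" "poly A (alpha (Suc m)) = 0"
  shows "A = 0"
proof -
  obtain h where h: "h \<noteq> 0" "Polynomial.smult h A \<in> polys_over (polys F m)"
    using common_denominator[OF assms(1)] by auto
  have "poly (Polynomial.smult h A) (alpha (Suc m)) = 0" using assms(2) by simp
  then have "Polynomial.smult h A = 0" using alpha_transcendental[OF h(2)] by blast
  then show ?thesis using h by simp
qed

text \<open>
  Transcendence of the last variable makes the polynomial in the definition of the degree unique.
\<close>

lemma deg_last_eval:
  assumes A: "A \<in> polys_over (ratfuns F m)" "A \<noteq> 0"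
  shows "deg_last F (Suc m) (poly A (alpha (Suc m))) = ereal (real (Polynomial.degree A))"
proof -
  interpret Q: unital_subring "ratfuns F m" by (rule unital_subring_ratfuns)
  interpret P: unital_subring "polys_over (ratfuns F m)" by (rule Q.unital_subring_polys_over)
  have "poly A (alpha (Suc m)) \<noteq> 0" using assms alpha_transcendental_over_ratfuns by blast
  moreover have "(THE B. (\<forall>i. Polynomial.coeff B i \<in> ratfuns F (Suc m - 1)) \<and>
      poly B (alpha (Suc m)) = poly A (alpha (Suc m))) = A"
  proof (rule the_equality)
    show "(\<forall>i. Polynomial.coeff A i \<in> ratfuns F (Suc m - 1)) \<and>
        poly A (alpha (Suc m)) = poly A (alpha (Suc m))"
      using A(1) by (simp add: polys_over_def)
    fix B assume "(\<forall>i. Polynomial.coeff B i \<in> ratfuns F (Suc m - 1)) \<and>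
        poly B (alpha (Suc m)) = poly A (alpha (Suc m))"
    then have "B \<in> polys_over (ratfuns F m)" "poly (B - A) (alpha (Suc m)) = 0"
      by (simp_all add: polys_over_def)
    then have "B - A = 0"
      using alpha_transcendental_over_ratfuns P.diff_closed A(1) by blast
    then show "B = A" by simp
  qed
  ultimately show ?thesis by (simp add: deg_last_def)
qed

lemma irreducible_in_polys:
  assumes d: "d \<in> polys F n" and irr: "ring_irreducible\<^bsub>polys_ring F n\<^esub> d"
  shows "irreducible_in (polys F n) d"
proof -
  interpret R: unital_subring "polys F n" by (rule unital_subring_polys)
  have units: "u \<in> Units (polys_ring F n) \<longleftrightarrow> unit_in (polys F n) u" for u
    unfolding Units_def unit_in_def dvd_in_def polys_ring_def ring_of_type_algebra_def
    by (auto simp: mult.commute)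
  have "d \<noteq> 0" and nonunit: "\<not> unit_in (polys F n) d"
    and pf: "\<And>x. x \<in> polys F n \<Longrightarrow> properfactor (polys_ring F n) x d \<Longrightarrow> unit_in (polys F n) x"
    using irr unfolding ring_irreducible_def Divisibility.irreducible_def units
    by (auto simp: polys_ring_def ring_of_type_algebra_def)
  have divides: "x divides\<^bsub>polys_ring F n\<^esub> y \<longleftrightarrow> dvd_in (polys F n) x y" for x y
    by (simp add: factor_def dvd_in_def polys_ring_def ring_of_type_algebra_def)
  have "unit_in (polys F n) x \<or> unit_in (polys F n) y"
    if xy: "x \<in> polys F n" "y \<in> polys F n" "d = x * y" for x y
  proof (cases "dvd_in (polys F n) d x")
    case True
    then obtain z where z: "z \<in> polys F n" "x = x * y * z" using xy by (auto simp: dvd_in_def)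
    have "x * 1 = x * (y * z)" using z(2) by (simp only: mult_1_right mult.assoc)
    moreover have "x \<noteq> 0" using \<open>d \<noteq> 0\<close> xy by auto
    ultimately have "1 = y * z" by (simp only: mult_cancel_left) simp
    then show ?thesis using z xy by (auto simp: unit_in_def dvd_in_def)
  next
    case False
    then have "properfactor (polys_ring F n) x d"
      using xy unfolding properfactor_def divides by (auto simp: dvd_in_def)
    then show ?thesis using pf xy by blast
  qed
  then show ?thesis using d \<open>d \<noteq> 0\<close> nonunit by (simp add: irreducible_in_def)
qed

end

lemma coefficient_field_if_subfield:
  assumes "subfield F (ring_of_type_algebra :: complex ring)"
  shows "coefficient_field F"
proof -
  let ?C = "ring_of_type_algebra :: complex ring"
  have sub: "subring F ?C" using assms by (rule subfieldE(1))
  have neg: "\<ominus>\<^bsub>?C\<^esub> y = - y" for y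
  proof -
    interpret C: ring ?C by (rule ring_from_type_algebra)
    show ?thesis
      by (rule C.minus_equality[symmetric, THEN sym])
        (auto simp: ring_of_type_algebra_def)
  qed
  have ops: "\<one>\<^bsub>?C\<^esub> = 1" "\<And>x y. x \<otimes>\<^bsub>?C\<^esub> y = x * y" "\<And>x y. x \<oplus>\<^bsub>?C\<^esub> y = x + y" "\<zero>\<^bsub>?C\<^esub> = 0"
    by (simp_all add: ring_of_type_algebra_def)
  have 1: "1 \<in> F" and mult: "\<And>x y. x \<in> F \<Longrightarrow> y \<in> F \<Longrightarrow> x * y \<in> F"
    and add: "\<And>x y. x \<in> F \<Longrightarrow> y \<in> F \<Longrightarrow> x + y \<in> F" and um: "\<And>x. x \<in> F \<Longrightarrow> - x \<in> F"
    using subringE(3,5,6,7)[OF sub] by (simp_all only: ops neg)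
  have "inverse x \<in> F" if "x \<in> F" for x
  proof (cases "x = 0")
    case True
    then show ?thesis using that by simp
  next
    case False
    then have "x \<in> Units (?C\<lparr>carrier := F\<rparr>)"
      using subfield.subfield_Units[OF assms] that by (simp add: ops)
    then obtain y where "y \<in> F" "y * x = 1"
      by (auto simp: Units_def ops)
    then show ?thesis by (metis inverse_unique mult.commute)
  qed
  moreover have "x - y \<in> F" if "x \<in> F" "y \<in> F" for x y
    using add[OF that(1) um[OF that(2)]] by simp
  ultimately show ?thesis
    using 1 mult by (intro coefficient_field.intro unital_subring.intro)
qed

section \<open>Automorphisms that scale the variables\<close>

locale diagonal_automorphism = coefficient_field F for F +
  fixes n :: nat and lam :: "nat \<Rightarrow> complex" and \<sigma> :: "ratfun \<Rightarrow> ratfun"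
  assumes lam: "\<And>i. i \<in> {1..n} \<Longrightarrow> lam i \<in> F - {0}"
    and iso: "\<sigma> \<in> ring_iso (ratfuns_ring F n) (ratfuns_ring F n)"
    and \<sigma>_const: "\<And>z. z \<in> F \<Longrightarrow> \<sigma> (const z) = const z"
    and \<sigma>_alpha: "\<And>i. i \<in> {1..n} \<Longrightarrow> \<sigma> (alpha i) = const (lam i) * alpha i"
begin

sublocale set_bijection "ratfuns F n" \<sigma>
  using iso by unfold_locales (simp add: ring_iso_def ratfuns_ring_def)

sublocale K: unital_subring "ratfuns F n" by (rule unital_subring_ratfuns)

lemma \<sigma>_add: "x \<in> ratfuns F n \<Longrightarrow> y \<in> ratfuns F n \<Longrightarrow> \<sigma> (x + y) = \<sigma> x + \<sigma> y"
  and \<sigma>_mult: "x \<in> ratfuns F n \<Longrightarrow> y \<in> ratfuns F n \<Longrightarrow> \<sigma> (x * y) = \<sigma> x * \<sigma> y"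
  using iso by (auto simp: ring_iso_def ring_hom_def ratfuns_ring_def ring_of_type_algebra_def)

lemma \<sigma>_diff: "x \<in> ratfuns F n \<Longrightarrow> y \<in> ratfuns F n \<Longrightarrow> \<sigma> (x - y) = \<sigma> x - \<sigma> y"
  using \<sigma>_add[of "x - y" y] K.diff_closed[of x y] by (simp add: eq_diff_eq)

lemma \<sigma>_0: "\<sigma> 0 = 0"
  using \<sigma>_diff[of 0 0] by simp

lemma polys_in_K: "m \<le> n \<Longrightarrow> x \<in> polys F m \<Longrightarrow> x \<in> ratfuns F n"
  using polys_subset_ratfuns[of n] polys_mono[of m n] by blast

text \<open>
  Both inclusions go by induction on the number of variables and on the polynomial in the last one.
  The new variable is the image of itself divided by its scaling factor.
\<close>

lemma \<sigma>_image_polys: "m \<le> n \<Longrightarrow> \<sigma> ` polys F m = polys F m"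
proof (induction m)
  case 0
  then show ?case by (auto simp: polys_0 \<sigma>_const image_iff)
next
  case (Suc m)
  let ?x = "alpha (Suc m)" and ?l = "lam (Suc m)"
  interpret R: unital_subring "polys F m" by (rule unital_subring_polys)
  interpret R': unital_subring "polys F (Suc m)" by (rule unital_subring_polys)
  have IH: "\<sigma> ` polys F m = polys F m" using Suc by simp
  have l: "?l \<in> F" "?l \<noteq> 0" using lam[of "Suc m"] Suc.prems by auto
  have x: "?x \<in> polys F (Suc m)" using alpha_in_polys by simp
  note in_K = polys_in_K[OF Suc.prems]
  have up: "polys F m \<subseteq> polys F (Suc m)" by (rule polys_mono) simp
  have \<sigma>x: "\<sigma> ?x = const ?l * ?x" using \<sigma>_alpha Suc.prems by simp
  have eval_closed: "poly A ?x \<in> polys F (Suc m)" if "A \<in> polys_over (polys F m)" for A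
    using that unfolding polys_Suc by blast
  have into: "\<sigma> (poly A ?x) \<in> polys F (Suc m)" if "A \<in> polys_over (polys F m)" for A
    using that
  proof (induction A)
    case 0
    then show ?case by (simp add: \<sigma>_0)
  next
    case (pCons a A)
    then have a: "a \<in> polys F m" and A: "A \<in> polys_over (polys F m)"
      by (auto simp: R.pCons_in_polys_over)
    have aK: "a \<in> ratfuns F n" using a up in_K by blast
    have AK: "poly A ?x \<in> ratfuns F n" using eval_closed[OF A] in_K by blast
    have "\<sigma> (poly (pCons a A) ?x) = \<sigma> a + const ?l * ?x * \<sigma> (poly A ?x)"
      using aK AK in_K[OF x] by (simp add: \<sigma>_add \<sigma>_mult K.mult_closed \<sigma>x)
    also have "\<dots> \<in> polys F (Suc m)"
      using a IH up x const_in_polys[OF l(1)] pCons.IH[OF A]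
      by (intro R'.add_closed R'.mult_closed) auto
    finally show ?case .
  qed
  have onto: "poly A ?x \<in> \<sigma> ` polys F (Suc m)" if "A \<in> polys_over (polys F m)" for A
    using that
  proof (induction A)
    case 0
    then show ?case by (simp add: \<sigma>_0 image_iff bexI[of _ 0])
  next
    case (pCons a A)
    then have a: "a \<in> polys F m" and A: "A \<in> polys_over (polys F m)"
      by (auto simp: R.pCons_in_polys_over)
    obtain a' where a': "a' \<in> polys F m" "a = \<sigma> a'" using a IH by blast
    obtain y where y: "y \<in> polys F (Suc m)" "poly A ?x = \<sigma> y" using pCons.IH[OF A] by blast
    let ?x' = "const (inverse ?l) * ?x"
    have x': "?x' \<in> polys F (Suc m)"
      using x const_in_polys inverse_F l by blast
    have "\<sigma> ?x' = const (inverse ?l) * (const ?l * ?x)"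
      using \<sigma>_mult in_K x const_in_polys inverse_F l by (simp add: \<sigma>_const \<sigma>x)
    also have "\<dots> = ?x" using l by (simp flip: const_mult mult.assoc)
    finally have \<sigma>x': "\<sigma> ?x' = ?x" .
    have "\<sigma> (a' + ?x' * y) = \<sigma> a' + \<sigma> ?x' * \<sigma> y"
      using \<sigma>_add \<sigma>_mult in_K x' y a' up by (simp add: K.mult_closed subset_iff)
    then have "poly (pCons a A) ?x = \<sigma> (a' + ?x' * y)"
      using a' y \<sigma>x' by simp
    moreover have "a' + ?x' * y \<in> polys F (Suc m)"
      using x' y a' up by blast
    ultimately show ?case by blast
  qed
  show ?case
    using into onto unfolding polys_Suc[of m] by blast
qed

lemma pow_image_polys: "m \<le> n \<Longrightarrow> pow k ` polys F m = polys F m"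
  by (rule pow_image_invariant[OF subsetI \<sigma>_image_polys]) (rule polys_in_K)

lemma ring_embedding_pow: "ring_embedding (polys F n) (pow k)"
proof -
  interpret R: unital_subring "polys F n" by (rule unital_subring_polys)
  show ?thesis
  proof
    show "pow k 1 = 1" using pow_fixed[of 1] \<sigma>_const[of 1] by simp
    show "inj_on (pow k) (polys F n)"
      using pow_inj polys_subset_ratfuns by (rule inj_on_subset)
    fix x y assume "x \<in> polys F n" "y \<in> polys F n"
    then have "x \<in> ratfuns F n" "y \<in> ratfuns F n" using polys_in_K by auto
    then show "pow k (x - y) = pow k x - pow k y" "pow k (x * y) = pow k x * pow k y"
      by (auto intro: pow_binary_hom \<sigma>_diff \<sigma>_mult)
  qed
qed

lemma ring_embedding_\<sigma>: "ring_embedding (polys F n) \<sigma>"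
proof -
  have "pow 1 = \<sigma>" by (simp add: auto_power_def fun_eq_iff)
  then show ?thesis using ring_embedding_pow[of 1] by simp
qed

lemma pow_dvd_iff:
  assumes "x \<in> polys F n" "y \<in> polys F n"
  shows "dvd_in (polys F n) (pow k x) (pow k y) \<longleftrightarrow> dvd_in (polys F n) x y"
  using ring_embedding.dvd_in_image[OF ring_embedding_pow assms] pow_image_polys by simp

lemma prime_in_pow:
  assumes "irreducible_in (polys F n) d"
  shows "prime_in (polys F n) (pow k d)"
proof -
  have "d \<in> polys F n" using assms by (simp add: irreducible_in_def)
  then have "irreducible_in (polys F n) (pow k d)"
    using assms ring_embedding.irreducible_in_image[OF ring_embedding_pow] pow_image_polys by simp
  then show ?thesis
    by (rule factorial_subring.irreducible_imp_prime[OF factorial_subring_polys])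
qed

text \<open>
  Irreducibility makes the cofactor a unit, hence a nonzero constant, which \<open>\<sigma>\<close> fixes; applying
  \<open>\<sigma>\<close> to the power \<open>-k\<close> moves the relation to \<open>d\<close> itself.
\<close>

lemma associated_translates:
  assumes irr: "irreducible_in (polys F n) d"
    and dvd: "dvd_in (polys F n) (pow k d) (pow l d)"
  shows "l - k \<in> Spr F n \<sigma> d d"
proof -
  interpret R: factorial_subring "polys F n" by (rule factorial_subring_polys)
  have dR: "d \<in> polys F n" using irr by (simp add: irreducible_in_def)
  have pk: "pow k d \<in> polys F n" "\<not> unit_in (polys F n) (pow k d)" for k
    using prime_in_pow[OF irr] by (auto simp: prime_in_def)
  obtain u where u: "u \<in> polys F n" "pow l d = pow k d * u" using dvd by (auto simp: dvd_in_def)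
  have "irreducible_in (polys F n) (pow l d)"
    using irr ring_embedding.irreducible_in_image[OF ring_embedding_pow dR] pow_image_polys by simp
  then have "unit_in (polys F n) u" using u pk unfolding irreducible_in_def by blast
  then obtain z where z: "z \<in> F - {0}" "u = const z" using unit_in_polys by blast
  have zK: "const z \<in> ratfuns F n" using const_in_polys z polys_in_K by blast
  have dK: "d \<in> ratfuns F n" using dR polys_in_K by blast
  have "pow (l - k) d = pow (- k) (pow l d)"
    using pow_add[OF dK, of "- k" l] by simp
  also have "\<dots> = pow (- k) (pow k d) * pow (- k) (const z)"
    unfolding u(2) z(2) using zK dK by (intro pow_binary_hom \<sigma>_mult K.mult_closed pow_in_K)
  also have "\<dots> = const z * d"
    using pow_add[OF dK, of "- k" k] pow_fixed[OF zK] \<sigma>_const z by simp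
  finally show ?thesis using z by (auto simp: Spr_def)
qed

end

theorem theorem3p6:
  fixes F :: "complex set" and n j :: nat and lam :: "nat \<Rightarrow> complex"
    and \<sigma> :: "ratfun \<Rightarrow> ratfun" and c :: complex and d a f :: ratfun
  assumes "subfield F (ring_of_type_algebra :: complex ring)"
    and "\<forall>z \<in> F. algebraic z"
    and "n \<ge> 1"
    and "\<forall>i \<in> {1..n}. lam i \<in> F - {0}"
    and "\<sigma> \<in> ring_iso (ratfuns_ring F n) (ratfuns_ring F n)"
    and "\<forall>z \<in> F. \<sigma> (const z) = const z"
    and "\<forall>i \<in> {1..n}. \<sigma> (alpha i) = const (lam i) * alpha i"
    and "c \<in> F - {0}"
    and "j \<noteq> 0"
    and "d \<in> polys F n"
    and "ring_irreducible\<^bsub>polys_ring F n\<^esub> d"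
    and "\<not> shift_equiv F n \<sigma> d (alpha n)"
    and "a \<in> polys_last F n"
    and "deg_last F n a < deg_last F n d"
    and "f = a / d ^ j"
    and "Spr F n \<sigma> d d = {0}"
  shows "csigma_summable F n c \<sigma> f \<longleftrightarrow> a = 0"
proof -
  interpret diagonal_automorphism F n lam \<sigma>
    using assms(4-7) coefficient_field_if_subfield[OF assms(1)]
    by (intro diagonal_automorphism.intro diagonal_automorphism_axioms.intro) auto
  interpret R: factorial_subring "polys F n" by (rule factorial_subring_polys)
  obtain m where n: "n = Suc m" using assms(3) by (cases n) auto
  interpret E: ring_embedding "polys_over (polys F m)" "\<lambda>A. poly A (alpha n)"
    unfolding n by (rule ring_embedding_eval)
  have eval_image: "(\<lambda>A. poly A (alpha n)) ` polys_over (polys F m) = polys F n"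
    unfolding n polys_Suc ..
  have irr: "irreducible_in (polys F n) d" using irreducible_in_polys assms(10,11) .
  then have d0: "d \<noteq> 0" by (simp add: irreducible_in_def)
  obtain D where D: "D \<in> polys_over (polys F m)" "d = poly D (alpha n)"
    using assms(10) unfolding eval_image[symmetric] by blast
  have D0: "D \<noteq> 0" using d0 D by auto
  have in_ratfuns: "A \<in> polys_over (ratfuns F m)" if "A \<in> polys_over (polys F m)" for A
    using that polys_subset_ratfuns by (auto simp: polys_over_def)
  have not_dvd: "\<not> dvd_in (polys F n) d (poly C (alpha n))"
    if C: "C \<in> polys_over (polys F m)" "C \<noteq> 0" "Polynomial.degree C < Polynomial.degree D" for C
  proof
    assume "dvd_in (polys F n) d (poly C (alpha n))"
    then have "dvd_in (polys_over (polys F m)) D C"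
      using E.dvd_in_image[OF D(1) C(1)] D(2) eval_image by simp
    then obtain B where "C = D * B" by (auto simp: dvd_in_def)
    then show False using C(2,3) degree_mult_eq[of D B] by auto
  qed
  show ?thesis
  proof
    assume "a = 0"
    then have "f = const c * \<sigma> 0 - 0" using assms(15) by (simp add: \<sigma>_0)
    then show "csigma_summable F n c \<sigma> f" unfolding csigma_summable_def by blast
  next
    assume "csigma_summable F n c \<sigma> f"
    then obtain g where g: "g \<in> ratfuns F n" "f = const c * \<sigma> g - g"
      by (auto simp: csigma_summable_def)
    then obtain P Q where PQ: "P \<in> polys F n" "Q \<in> polys F n" "Q \<noteq> 0" "g = P / Q"
      by (auto simp: ratfuns_def)
    show "a = 0"
    proof (rule ccontr)
      assume "a \<noteq> 0"
      obtain A where A: "A \<in> polys_over (ratfuns F m)" "a = poly A (alpha n)"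
        using assms(13) by (auto simp: polys_last_def polys_over_def n)
      have A0: "A \<noteq> 0" using \<open>a \<noteq> 0\<close> A by auto
      have deg: "Polynomial.degree A < Polynomial.degree D"
        using assms(14) deg_last_eval[OF A(1) A0] deg_last_eval[OF in_ratfuns[OF D(1)] D0] A D
        by (simp add: n)
      obtain h where h: "h \<in> polys F m" "h \<noteq> 0" "Polynomial.smult h A \<in> polys_over (polys F m)"
        using common_denominator[OF A(1)] by blast
      define b where "b = h * a"
      have b: "b = poly (Polynomial.smult h A) (alpha n)" by (simp add: b_def A)
      have bR: "b \<in> polys F n" unfolding b eval_image[symmetric] using h(3) by blast
      have hR: "h \<in> polys F n" using h polys_mono[of m n] n by auto
      have db: "\<not> dvd_in (polys F n) (pow 0 d) b"
        unfolding b using not_dvd[OF h(3)] h(2) A0 deg by (simp del: poly_smult)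
      \<comment> \<open>The \<open>-k\<close>-th power of \<open>\<sigma>\<close> keeps \<open>h\<close> free of the last variable, which reduces the claim to \<open>d\<close>.\<close>
      have dh: "\<not> dvd_in (polys F n) (pow k d) h" for k
      proof -
        obtain h' where h': "h' \<in> polys F m" "h = pow k h'"
          using h(1) pow_image_polys[of m k] n by auto
        have "h' \<noteq> 0" using h' h(2) pow_fixed[of 0 k] \<sigma>_0 by auto
        moreover have "[:h':] \<in> polys_over (polys F m)"
          using h' unital_subring.const_in_polys_over[OF unital_subring_polys] by simp
        ultimately have "\<not> dvd_in (polys F n) d h'" using not_dvd[of "[:h':]"] deg by simp
        moreover have "h' \<in> polys F n" using h' polys_mono[of m n] n by auto
        ultimately show ?thesis using pow_dvd_iff assms(10) h' by simp
      qed
      interpret O: prime_orbit "polys F n" \<sigma> "\<lambda>k. pow k d" "const c"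
      proof (intro prime_orbit.intro prime_orbit_axioms.intro factorial_subring_polys
          ring_embedding_\<sigma> \<sigma>_image_polys order_refl prime_in_pow irr)
        show "k = l" if "dvd_in (polys F n) (pow k d) (pow l d)" for k l
          using associated_translates[OF irr that] assms(16) by auto
        show "\<sigma> (pow k d) = pow (k + 1) d" for k
          using pow_Suc[OF polys_in_K[OF order_refl assms(10)]] by simp
        have "const c * const (inverse c) = 1" using assms(8) by (simp flip: const_mult)
        then show "unit_in (polys F n) (const c)"
          using assms(8) const_in_polys inverse_F unfolding unit_in_def dvd_in_def
          by (metis DiffD1)
      qed
      have K: "P \<in> ratfuns F n" "Q \<in> ratfuns F n" using PQ polys_in_K by auto
      have \<sigma>Q: "\<sigma> Q \<noteq> 0" using PQ O.hom_eq_0_iff by blast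
      have "\<sigma> g * \<sigma> Q = \<sigma> P"
        using \<sigma>_mult[OF g(1) K(2)] PQ by simp
      then have "\<sigma> g = \<sigma> P / \<sigma> Q" using \<sigma>Q by (simp add: field_simps)
      then have "b / (h * d ^ j) = const c * (\<sigma> P / \<sigma> Q) - P / Q"
        using g(2) PQ(4) assms(15) h(2) by (simp add: b_def)
      then have "b * Q * \<sigma> Q = h * d ^ j * (const c * \<sigma> P * Q - P * \<sigma> Q)"
        using \<sigma>Q PQ(3) h(2) d0 by (simp add: field_simps)
      then show False
        using O.no_solution[OF PQ(1,2) bR hR PQ(3) db dh assms(9)] by simp
    qed
  qed
qed

end
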